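(* Let $S,T\in\widehat{\mathcal{C}}_\hbar$ be invertible and let $h$ be the hermitian form on the free right module $\mathcal{X}(\widehat{\mathcal{C}}_\hbar)$ with basis $\{\Phi,\bar\Phi\}$ determined by $h(\Phi,\Phi)=S$, $h(\bar\Phi,\bar\Phi)=T$, $h(\Phi,\bar\Phi)=0$. Then there exists a unique hermitian, torsion-free, almost complex connection $\nabla$ on $\mathcal{X}(\widehat{\mathcal{C}}_\hbar)$, and it is given by $$\nabla_\partial\Phi=\Phi\,S^{-1}\partial S,\qquad \nabla_{\bar\partial}\bar\Phi=\bar\Phi\,T^{-1}\bar\partial T,\qquad \nabla_{\bar\partial}\Phi=\nabla_\partial\bar\Phi=0.$$
   Context: Let $\hbar\in\mathbb{R}$. $\mathcal{C}_\hbar$ is the unital associative $\mathbb{C}$-algebra with generators $U,R,R^{-1},W,W^{-1}$ and relations $WW^{-1}=W^{-1}W=1$, $RR^{-1}=R^{-1}R=1$, $RU=UR$, $R^{-1}U=UR^{-1}$, $WR=e^{\hbar}RW$, $WR^{-1}=e^{-\hbar}R^{-1}W$, $W^{-1}R=e^{-\hbar}RW^{-1}$, $W^{-1}R^{-1}=e^{\hbar}R^{-1}W^{-1}$, $WU=UW+\hbar W$, $W^{-1}U=UW^{-1}-\hbar W^{-1}$. It is a $*$-algebra via $U^*=U$, $R^*=R$, $W^*=W^{-1}$. Localization: let $Z_\hbar(U,R)$ be the commutative subalgebra generated by $1,U,R,R^{-1}$, let $\phi:Z_\hbar(U,R)\to C^\infty(\mathbb{R})$ be the algebra homomorphism $\phi(U)=u$,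 $\phi(R)=e^u$, $\phi(R^{-1})=e^{-u}$, and let $Z^+_\hbar(U,R)=\{p\in Z_\hbar(U,R):|\phi(p)(u)|>0\ \forall u\in\mathbb{R}\}$. $\widehat{\mathcal{C}}_\hbar$ is the universal localization of $\mathcal{C}_\hbar$ at $Z^+_\hbar(U,R)$ (the universal algebra receiving a homomorphism from $\mathcal{C}_\hbar$ under which all elements of $Z_\hbar^+(U,R)$ become invertible); $\mathcal{C}_\hbar$ embeds in it. The involution and derivations of $\mathcal{C}_\hbar$ are extended to $\widehat{\mathcal{C}}_\hbar$. Derivations: $\partial_u,\partial_v$ are the commuting hermitian derivations ($d(a^* )=d(a)^*$) with $\partial_uU=1$, $\partial_uR=R$, $\partial_uW=0$, $\partial_vU=0$, $\partial_vR=0$, $\partial_vW=iW$. Let $\partial=\frac12(\partial_u-i\partial_v)$, $\bar\partial=\frac12(\partial_u+i\partial_v)$, and let $\mathfrak{g}$ be the complex abelian Lie algebra spanned by $\partial_u,\partial_v$. For $d\in\mathfrak{g}$, $d^*(a)=(d(a^* ))^*$, so $\partial^*=\bar\partial$. Module: $e_1,e_2,e_3$ is the canonical basis of the free right module $(\widehat{\mathcal{C}}_\hbar)^3$; $\Phi^1=\frac12e^{\hbar/2}(RW-R^{-1}W^{-1})$, $\Phi^2=-\frac i2e^{\hbar/2}(RW+R^{-1}W^{-1})$, $\Phi^3=1$; $\Phi=\sum_ie_i\Phi^i$, $\bar\Phi=\sum_ie_i(\Phi^i)^*$; $\mathcal{X}(\widehat{\mathcal{C}}_\hbar)$ is the right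 submodule generated by $\Phi,\bar\Phi$, which is free with basis $\{\Phi,\bar\Phi\}$. A hermitian form $h$ satisfies $h(X,Y+Z)=h(X,Y)+h(X,Z)$, $h(X,Y)^*=h(Y,X)$, $h(X,Ya)=h(X,Y)a$ (in particular $S,T$ are self-adjoint). A connection is a map $\nabla:\mathfrak{g}\times\mathcal{X}(\widehat{\mathcal{C}}_\hbar)\to\mathcal{X}(\widehat{\mathcal{C}}_\hbar)$, $\mathbb{C}$-linear in each argument, with $\nabla_d(Xa)=(\nabla_dX)a+X\,d(a)$ for $a\in\widehat{\mathcal{C}}_\hbar$. It is hermitian if $d\,h(X,Y)=h(\nabla_{d^*}X,Y)+h(X,\nabla_dY)$ for all $d\in\mathfrak{g}$ and all $X,Y$; torsion-free if $\nabla_\partial\bar\Phi=\nabla_{\bar\partial}\Phi$; almost complex if $\nabla_d(JX)=J\nabla_dX$ for all $d\in\mathfrak{g}$ and all $X$, where $J$ is the right module homomorphism with $J\Phi=i\Phi$, $J\bar\Phi=-i\bar\Phi$. *)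

theory Defs
  imports Complex_Main "HOL-Algebra.Module"
begin

section \<open>Complex algebras\<close>

text \<open>
  A unital associative complex algebra is a record of type \<open>(complex, 'a) module\<close> (a ring
  together with \<open>smult\<close>). The locale \<^locale>\<open>algebra\<close> of the library is not used because it
  only covers commutative algebras.
\<close>

type_synonym 'a calg = "(complex, 'a) module"

definition alg_hom :: "'a calg \<Rightarrow> 'b calg \<Rightarrow> ('a \<Rightarrow> 'b) \<Rightarrow> bool" where
  "alg_hom A B f \<longleftrightarrow> f \<in> ring_hom A B \<and>
     (\<forall>c. \<forall>a \<in> carrier A. f (c \<odot>\<^bsub>A\<^esub> a) = c \<odot>\<^bsub>B\<^esub> f a)"

inductive_set gen_subalg :: "'a calg \<Rightarrow> 'a set \<Rightarrow> 'a set" for A :: "'a calg" and X :: "'a set" where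
  gen: "x \<in> X \<Longrightarrow> x \<in> gen_subalg A X"
| one: "\<one>\<^bsub>A\<^esub> \<in> gen_subalg A X"
| add: "a \<in> gen_subalg A X \<Longrightarrow> b \<in> gen_subalg A X \<Longrightarrow> a \<oplus>\<^bsub>A\<^esub> b \<in> gen_subalg A X"
| mult: "a \<in> gen_subalg A X \<Longrightarrow> b \<in> gen_subalg A X \<Longrightarrow> a \<otimes>\<^bsub>A\<^esub> b \<in> gen_subalg A X"
| smult: "a \<in> gen_subalg A X \<Longrightarrow> c \<odot>\<^bsub>A\<^esub> a \<in> gen_subalg A X"

text \<open>
  Involutions and derivations are extensional functions on the carrier, so that they are equal
  as soon as they agree on the algebra.
\<close>

definition star_involution :: "'a calg \<Rightarrow> ('a \<Rightarrow> 'a) \<Rightarrow> bool" where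
  "star_involution A s \<longleftrightarrow>
     s \<in> carrier A \<rightarrow>\<^sub>E carrier A \<and>
     (\<forall>a \<in> carrier A. \<forall>b \<in> carrier A. s (a \<oplus>\<^bsub>A\<^esub> b) = s a \<oplus>\<^bsub>A\<^esub> s b) \<and>
     (\<forall>c. \<forall>a \<in> carrier A. s (c \<odot>\<^bsub>A\<^esub> a) = cnj c \<odot>\<^bsub>A\<^esub> s a) \<and>
     (\<forall>a \<in> carrier A. \<forall>b \<in> carrier A. s (a \<otimes>\<^bsub>A\<^esub> b) = s b \<otimes>\<^bsub>A\<^esub> s a) \<and>
     (\<forall>a \<in> carrier A. s (s a) = a)"

definition derivation :: "'a calg \<Rightarrow> ('a \<Rightarrow> 'a) \<Rightarrow> bool" where
  "derivation A d \<longleftrightarrow>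
     d \<in> carrier A \<rightarrow>\<^sub>E carrier A \<and>
     (\<forall>a \<in> carrier A. \<forall>b \<in> carrier A. d (a \<oplus>\<^bsub>A\<^esub> b) = d a \<oplus>\<^bsub>A\<^esub> d b) \<and>
     (\<forall>c. \<forall>a \<in> carrier A. d (c \<odot>\<^bsub>A\<^esub> a) = c \<odot>\<^bsub>A\<^esub> d a) \<and>
     (\<forall>a \<in> carrier A. \<forall>b \<in> carrier A. d (a \<otimes>\<^bsub>A\<^esub> b) = (d a \<otimes>\<^bsub>A\<^esub> b) \<oplus>\<^bsub>A\<^esub> (a \<otimes>\<^bsub>A\<^esub> d b))"

definition hermitian_derivation :: "'a calg \<Rightarrow> ('a \<Rightarrow> 'a) \<Rightarrow> ('a \<Rightarrow> 'a) \<Rightarrow> bool" where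
  "hermitian_derivation A s d \<longleftrightarrow> derivation A d \<and> (\<forall>a \<in> carrier A. d (s a) = s (d a))"


section \<open>Algebras given by generators and relations\<close>

datatype (gens: 'g) aterm =
    Gen 'g
  | Scalar complex
  | Plus "'g aterm" "'g aterm" (infixl "\<boxplus>" 65)
  | Times "'g aterm" "'g aterm" (infixl "\<boxtimes>" 70)

text \<open>
  The smallest congruence on terms that contains the given relations and the axioms of unital
  associative complex algebras; \<open>Scalar c\<close> stands for $c \cdot 1$.
\<close>

inductive acong :: "('g aterm \<times> 'g aterm) set \<Rightarrow> 'g aterm \<Rightarrow> 'g aterm \<Rightarrow> bool"
  for Rel :: "('g aterm \<times> 'g aterm) set" where
  rel: "(s, t) \<in> Rel \<Longrightarrow> acong Rel s t"
| refl: "acong Rel t t"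
| sym: "acong Rel s t \<Longrightarrow> acong Rel t s"
| trans: "acong Rel s t \<Longrightarrow> acong Rel t u \<Longrightarrow> acong Rel s u"
| plus_cong: "acong Rel s s' \<Longrightarrow> acong Rel t t' \<Longrightarrow> acong Rel (s \<boxplus> t) (s' \<boxplus> t')"
| times_cong: "acong Rel s s' \<Longrightarrow> acong Rel t t' \<Longrightarrow> acong Rel (s \<boxtimes> t) (s' \<boxtimes> t')"
| plus_assoc: "acong Rel ((s \<boxplus> t) \<boxplus> u) (s \<boxplus> (t \<boxplus> u))"
| plus_comm: "acong Rel (s \<boxplus> t) (t \<boxplus> s)"
| plus_zero: "acong Rel (Scalar 0 \<boxplus> t) t"
| plus_inverse: "acong Rel ((Scalar (- 1) \<boxtimes> t) \<boxplus> t) (Scalar 0)"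
| times_assoc: "acong Rel ((s \<boxtimes> t) \<boxtimes> u) (s \<boxtimes> (t \<boxtimes> u))"
| one_times: "acong Rel (Scalar 1 \<boxtimes> t) t"
| times_one: "acong Rel (t \<boxtimes> Scalar 1) t"
| distrib_right: "acong Rel ((s \<boxplus> t) \<boxtimes> u) ((s \<boxtimes> u) \<boxplus> (t \<boxtimes> u))"
| distrib_left: "acong Rel (s \<boxtimes> (t \<boxplus> u)) ((s \<boxtimes> t) \<boxplus> (s \<boxtimes> u))"
| scalar_plus: "acong Rel (Scalar (c + c')) (Scalar c \<boxplus> Scalar c')"
| scalar_times: "acong Rel (Scalar (c * c')) (Scalar c \<boxtimes> Scalar c')"
| scalar_central: "acong Rel (Scalar c \<boxtimes> t) (t \<boxtimes> Scalar c)"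

definition acls :: "('g aterm \<times> 'g aterm) set \<Rightarrow> 'g aterm \<Rightarrow> 'g aterm set" where
  "acls Rel t = {s. acong Rel t s}"

text \<open>
  The algebra with generators \<open>X\<close> and relations \<open>Rel\<close> (between terms over \<open>X\<close>). The elements are
  the classes of the terms over \<open>X\<close>; each class has a representative over \<open>X\<close>, and terms
  with other generators in it are harmless, since mapping those generators to $0$ respects the
  congruence.
\<close>

definition presented_alg :: "'g set \<Rightarrow> ('g aterm \<times> 'g aterm) set \<Rightarrow> 'g aterm set calg" where
  "presented_alg X Rel =
     \<lparr>carrier = {acls Rel t | t. gens t \<subseteq> X},
      mult = (\<lambda>P Q. \<Union>p \<in> P. \<Union>q \<in> Q. acls Rel (p \<boxtimes> q)),
      one = acls Rel (Scalar 1),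
      zero = acls Rel (Scalar 0),
      add = (\<lambda>P Q. \<Union>p \<in> P. \<Union>q \<in> Q. acls Rel (p \<boxplus> q)),
      smult = (\<lambda>c P. \<Union>p \<in> P. acls Rel (Scalar c \<boxtimes> p))\<rparr>"


section \<open>Universal localization\<close>

datatype 'a locgen = Elem 'a | FormalInv 'a

text \<open>
  The first four families of relations say that \<open>Elem\<close> is an algebra homomorphism.
\<close>

inductive_set loc_rels :: "'a calg \<Rightarrow> 'a set \<Rightarrow> ('a locgen aterm \<times> 'a locgen aterm) set"
  for A :: "'a calg" and \<Sigma> :: "'a set" where
  "a \<in> carrier A \<Longrightarrow> b \<in> carrier A \<Longrightarrow>
     (Gen (Elem (a \<oplus>\<^bsub>A\<^esub> b)), Gen (Elem a) \<boxplus> Gen (Elem b)) \<in> loc_rels A \<Sigma>"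
| "a \<in> carrier A \<Longrightarrow> b \<in> carrier A \<Longrightarrow>
     (Gen (Elem (a \<otimes>\<^bsub>A\<^esub> b)), Gen (Elem a) \<boxtimes> Gen (Elem b)) \<in> loc_rels A \<Sigma>"
| "a \<in> carrier A \<Longrightarrow>
     (Gen (Elem (c \<odot>\<^bsub>A\<^esub> a)), Scalar c \<boxtimes> Gen (Elem a)) \<in> loc_rels A \<Sigma>"
| "(Gen (Elem \<one>\<^bsub>A\<^esub>), Scalar 1) \<in> loc_rels A \<Sigma>"
| "z \<in> \<Sigma> \<Longrightarrow> (Gen (Elem z) \<boxtimes> Gen (FormalInv z), Scalar 1) \<in> loc_rels A \<Sigma>"
| "z \<in> \<Sigma> \<Longrightarrow> (Gen (FormalInv z) \<boxtimes> Gen (Elem z), Scalar 1) \<in> loc_rels A \<Sigma>"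

definition localization :: "'a calg \<Rightarrow> 'a set \<Rightarrow> 'a locgen aterm set calg" where
  "localization A \<Sigma> = presented_alg (Elem ` carrier A \<union> FormalInv ` \<Sigma>) (loc_rels A \<Sigma>)"

definition loc_map :: "'a calg \<Rightarrow> 'a set \<Rightarrow> 'a \<Rightarrow> 'a locgen aterm set" where
  "loc_map A \<Sigma> a = acls (loc_rels A \<Sigma>) (Gen (Elem a))"


section \<open>The algebra of the catenoid\<close>

text \<open>Throughout, \<open>k\<close> is the real deformation parameter $\hbar$.\<close>

datatype cgen = cU | cR | cRinv | cW | cWinv

definition cat_rels :: "real \<Rightarrow> (cgen aterm \<times> cgen aterm) set" where
  "cat_rels k =
    {(Gen cW \<boxtimes> Gen cWinv, Scalar 1), (Gen cWinv \<boxtimes> Gen cW, Scalar 1),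
     (Gen cR \<boxtimes> Gen cRinv, Scalar 1), (Gen cRinv \<boxtimes> Gen cR, Scalar 1),
     (Gen cR \<boxtimes> Gen cU, Gen cU \<boxtimes> Gen cR),
     (Gen cRinv \<boxtimes> Gen cU, Gen cU \<boxtimes> Gen cRinv),
     (Gen cW \<boxtimes> Gen cR, Scalar (of_real (exp k)) \<boxtimes> (Gen cR \<boxtimes> Gen cW)),
     (Gen cW \<boxtimes> Gen cRinv, Scalar (of_real (exp (- k))) \<boxtimes> (Gen cRinv \<boxtimes> Gen cW)),
     (Gen cWinv \<boxtimes> Gen cR, Scalar (of_real (exp (- k))) \<boxtimes> (Gen cR \<boxtimes> Gen cWinv)),
     (Gen cWinv \<boxtimes> Gen cRinv, Scalar (of_real (exp k)) \<boxtimes> (Gen cRinv \<boxtimes> Gen cWinv)),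
     (Gen cW \<boxtimes> Gen cU, (Gen cU \<boxtimes> Gen cW) \<boxplus> (Scalar (of_real k) \<boxtimes> Gen cW)),
     (Gen cWinv \<boxtimes> Gen cU, (Gen cU \<boxtimes> Gen cWinv) \<boxplus> (Scalar (- of_real k) \<boxtimes> Gen cWinv))}"

definition cat_alg :: "real \<Rightarrow> cgen aterm set calg" where
  "cat_alg k = presented_alg UNIV (cat_rels k)"

definition cat_gen :: "real \<Rightarrow> cgen \<Rightarrow> cgen aterm set" where
  "cat_gen k g = acls (cat_rels k) (Gen g)"

definition cat_star :: "real \<Rightarrow> cgen aterm set \<Rightarrow> cgen aterm set" where
  "cat_star k = (THE s. star_involution (cat_alg k) s \<and>
     s (cat_gen k cU) = cat_gen k cU \<and> s (cat_gen k cR) = cat_gen k cR \<and>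
     s (cat_gen k cW) = cat_gen k cWinv)"

text \<open>
  The values on the generators determine the derivations; in particular they commute
  automatically.
\<close>

definition cat_du :: "real \<Rightarrow> cgen aterm set \<Rightarrow> cgen aterm set" where
  "cat_du k = (THE d. hermitian_derivation (cat_alg k) (cat_star k) d \<and>
     d (cat_gen k cU) = \<one>\<^bsub>cat_alg k\<^esub> \<and> d (cat_gen k cR) = cat_gen k cR \<and>
     d (cat_gen k cW) = \<zero>\<^bsub>cat_alg k\<^esub>)"

definition cat_dv :: "real \<Rightarrow> cgen aterm set \<Rightarrow> cgen aterm set" where
  "cat_dv k = (THE d. hermitian_derivation (cat_alg k) (cat_star k) d \<and>
     d (cat_gen k cU) = \<zero>\<^bsub>cat_alg k\<^esub> \<and> d (cat_gen k cR) = \<zero>\<^bsub>cat_alg k\<^esub> \<and>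
     d (cat_gen k cW) = \<i> \<odot>\<^bsub>cat_alg k\<^esub> cat_gen k cW)"

definition smooth :: "(real \<Rightarrow> complex) \<Rightarrow> bool" where
  "smooth f \<longleftrightarrow> (\<exists>F :: nat \<Rightarrow> real \<Rightarrow> complex. F 0 = f \<and>
     (\<forall>n x. (F n has_vector_derivative F (Suc n) x) (at x)))"

definition smooth_alg :: "(real \<Rightarrow> complex) calg" where
  "smooth_alg =
     \<lparr>carrier = {f. smooth f}, mult = (\<lambda>f g x. f x * g x), one = (\<lambda>x. 1),
      zero = (\<lambda>x. 0), add = (\<lambda>f g x. f x + g x), smult = (\<lambda>c f x. c * f x)\<rparr>"

definition cat_Z :: "real \<Rightarrow> cgen aterm set set" where
  "cat_Z k = gen_subalg (cat_alg k) {cat_gen k cU, cat_gen k cR, cat_gen k cRinv}"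

definition cat_phi :: "real \<Rightarrow> cgen aterm set \<Rightarrow> real \<Rightarrow> complex" where
  "cat_phi k = (THE \<phi>. \<phi> \<in> extensional (cat_Z k) \<and>
     alg_hom ((cat_alg k)\<lparr>carrier := cat_Z k\<rparr>) smooth_alg \<phi> \<and>
     \<phi> (cat_gen k cU) = (\<lambda>u. of_real u) \<and>
     \<phi> (cat_gen k cR) = (\<lambda>u. of_real (exp u)) \<and>
     \<phi> (cat_gen k cRinv) = (\<lambda>u. of_real (exp (- u))))"

definition cat_Zplus :: "real \<Rightarrow> cgen aterm set set" where
  "cat_Zplus k = {p \<in> cat_Z k. \<forall>u. cmod (cat_phi k p u) > 0}"


section \<open>The localized algebra\<close>

type_synonym hat = "cgen aterm set locgen aterm set"

definition hat_alg :: "real \<Rightarrow> hat calg" where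
  "hat_alg k = localization (cat_alg k) (cat_Zplus k)"

definition hat_emb :: "real \<Rightarrow> cgen aterm set \<Rightarrow> hat" where
  "hat_emb k = loc_map (cat_alg k) (cat_Zplus k)"

definition hat_star :: "real \<Rightarrow> hat \<Rightarrow> hat" where
  "hat_star k = (THE s. star_involution (hat_alg k) s \<and>
     (\<forall>a \<in> carrier (cat_alg k). s (hat_emb k a) = hat_emb k (cat_star k a)))"

definition hat_du :: "real \<Rightarrow> hat \<Rightarrow> hat" where
  "hat_du k = (THE d. derivation (hat_alg k) d \<and>
     (\<forall>a \<in> carrier (cat_alg k). d (hat_emb k a) = hat_emb k (cat_du k a)))"

definition hat_dv :: "real \<Rightarrow> hat \<Rightarrow> hat" where
  "hat_dv k = (THE d. derivation (hat_alg k) d \<and>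
     (\<forall>a \<in> carrier (cat_alg k). d (hat_emb k a) = hat_emb k (cat_dv k a)))"

definition lincomb :: "real \<Rightarrow> complex \<Rightarrow> (hat \<Rightarrow> hat) \<Rightarrow> complex \<Rightarrow> (hat \<Rightarrow> hat) \<Rightarrow> hat \<Rightarrow> hat" where
  "lincomb k c d c' d' = (\<lambda>a \<in> carrier (hat_alg k).
     (c \<odot>\<^bsub>hat_alg k\<^esub> d a) \<oplus>\<^bsub>hat_alg k\<^esub> (c' \<odot>\<^bsub>hat_alg k\<^esub> d' a))"

definition lie_g :: "real \<Rightarrow> (hat \<Rightarrow> hat) set" where
  "lie_g k = {lincomb k c (hat_du k) c' (hat_dv k) | c c'. True}"

definition hat_d :: "real \<Rightarrow> hat \<Rightarrow> hat" where
  "hat_d k = lincomb k (1 / 2) (hat_du k) (- \<i> / 2) (hat_dv k)"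

definition hat_dbar :: "real \<Rightarrow> hat \<Rightarrow> hat" where
  "hat_dbar k = lincomb k (1 / 2) (hat_du k) (\<i> / 2) (hat_dv k)"

definition der_star :: "real \<Rightarrow> (hat \<Rightarrow> hat) \<Rightarrow> hat \<Rightarrow> hat" where
  "der_star k d = (\<lambda>a \<in> carrier (hat_alg k). hat_star k (d (hat_star k a)))"


section \<open>The module of vector fields\<close>

text \<open>
  An element $e_1 x_1 + e_2 x_2 + e_3 x_3$ of the free right module of rank 3 is the triple
  \<open>(x1, x2, x3)\<close>.
\<close>

type_synonym vec3 = "hat \<times> hat \<times> hat"

fun vadd :: "real \<Rightarrow> vec3 \<Rightarrow> vec3 \<Rightarrow> vec3" where
  "vadd k (x1, x2, x3) (y1, y2, y3) =
     (x1 \<oplus>\<^bsub>hat_alg k\<^esub> y1, x2 \<oplus>\<^bsub>hat_alg k\<^esub> y2, x3 \<oplus>\<^bsub>hat_alg k\<^esub> y3)"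

fun vact :: "real \<Rightarrow> vec3 \<Rightarrow> hat \<Rightarrow> vec3" where
  "vact k (x1, x2, x3) a =
     (x1 \<otimes>\<^bsub>hat_alg k\<^esub> a, x2 \<otimes>\<^bsub>hat_alg k\<^esub> a, x3 \<otimes>\<^bsub>hat_alg k\<^esub> a)"

fun vsmult :: "real \<Rightarrow> complex \<Rightarrow> vec3 \<Rightarrow> vec3" where
  "vsmult k c (x1, x2, x3) =
     (c \<odot>\<^bsub>hat_alg k\<^esub> x1, c \<odot>\<^bsub>hat_alg k\<^esub> x2, c \<odot>\<^bsub>hat_alg k\<^esub> x3)"

definition vzero :: "real \<Rightarrow> vec3" where
  "vzero k = (\<zero>\<^bsub>hat_alg k\<^esub>, \<zero>\<^bsub>hat_alg k\<^esub>, \<zero>\<^bsub>hat_alg k\<^esub>)"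

definition Phi :: "real \<Rightarrow> vec3" where
  "Phi k = (let A = hat_alg k; r = hat_emb k (cat_gen k cR); r' = hat_emb k (cat_gen k cRinv);
                w = hat_emb k (cat_gen k cW); w' = hat_emb k (cat_gen k cWinv)
     in ((1 / 2 * of_real (exp (k / 2))) \<odot>\<^bsub>A\<^esub> ((r \<otimes>\<^bsub>A\<^esub> w) \<ominus>\<^bsub>A\<^esub> (r' \<otimes>\<^bsub>A\<^esub> w')),
         (- \<i> / 2 * of_real (exp (k / 2))) \<odot>\<^bsub>A\<^esub> ((r \<otimes>\<^bsub>A\<^esub> w) \<oplus>\<^bsub>A\<^esub> (r' \<otimes>\<^bsub>A\<^esub> w')),
         \<one>\<^bsub>A\<^esub>))"

definition Phibar :: "real \<Rightarrow> vec3" where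
  "Phibar k = (case Phi k of (x1, x2, x3) \<Rightarrow> (hat_star k x1, hat_star k x2, hat_star k x3))"

definition vfields :: "real \<Rightarrow> vec3 set" where
  "vfields k = {vadd k (vact k (Phi k) a) (vact k (Phibar k) b) | a b.
     a \<in> carrier (hat_alg k) \<and> b \<in> carrier (hat_alg k)}"

definition module_hom :: "real \<Rightarrow> (vec3 \<Rightarrow> vec3) \<Rightarrow> bool" where
  "module_hom k f \<longleftrightarrow> f \<in> vfields k \<rightarrow>\<^sub>E vfields k \<and>
     (\<forall>X \<in> vfields k. \<forall>Y \<in> vfields k. f (vadd k X Y) = vadd k (f X) (f Y)) \<and>
     (\<forall>X \<in> vfields k. \<forall>a \<in> carrier (hat_alg k). f (vact k X a) = vact k (f X) a)"

definition Jmap :: "real \<Rightarrow> vec3 \<Rightarrow> vec3" where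
  "Jmap k = (THE f. module_hom k f \<and> f (Phi k) = vsmult k \<i> (Phi k) \<and>
     f (Phibar k) = vsmult k (- \<i>) (Phibar k))"

definition hermitian_form :: "real \<Rightarrow> (vec3 \<Rightarrow> vec3 \<Rightarrow> hat) \<Rightarrow> bool" where
  "hermitian_form k h \<longleftrightarrow>
     (\<forall>X \<in> vfields k. \<forall>Y \<in> vfields k. h X Y \<in> carrier (hat_alg k)) \<and>
     (\<forall>X \<in> vfields k. \<forall>Y \<in> vfields k. \<forall>Z \<in> vfields k.
        h X (vadd k Y Z) = h X Y \<oplus>\<^bsub>hat_alg k\<^esub> h X Z) \<and>
     (\<forall>X \<in> vfields k. \<forall>Y \<in> vfields k. hat_star k (h X Y) = h Y X) \<and>
     (\<forall>X \<in> vfields k. \<forall>Y \<in> vfields k. \<forall>a \<in> carrier (hat_alg k).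
        h X (vact k Y a) = h X Y \<otimes>\<^bsub>hat_alg k\<^esub> a)"


section \<open>Connections\<close>

text \<open>
  A connection is an extensional function on pairs \<open>(d, X)\<close>, so that equality of functions is
  equality of connections.
\<close>

type_synonym conn = "(hat \<Rightarrow> hat) \<times> vec3 \<Rightarrow> vec3"

definition connection :: "real \<Rightarrow> conn \<Rightarrow> bool" where
  "connection k N \<longleftrightarrow>
     N \<in> (lie_g k \<times> vfields k) \<rightarrow>\<^sub>E vfields k \<and>
     (\<forall>d \<in> lie_g k. \<forall>d' \<in> lie_g k. \<forall>c c'. \<forall>X \<in> vfields k.
        N (lincomb k c d c' d', X) = vadd k (vsmult k c (N (d, X))) (vsmult k c' (N (d', X)))) \<and>
     (\<forall>d \<in> lie_g k. \<forall>c c'. \<forall>X \<in> vfields k. \<forall>Y \<in> vfields k.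
        N (d, vadd k (vsmult k c X) (vsmult k c' Y)) =
          vadd k (vsmult k c (N (d, X))) (vsmult k c' (N (d, Y)))) \<and>
     (\<forall>d \<in> lie_g k. \<forall>X \<in> vfields k. \<forall>a \<in> carrier (hat_alg k).
        N (d, vact k X a) = vadd k (vact k (N (d, X)) a) (vact k X (d a)))"

definition hermitian_conn :: "real \<Rightarrow> (vec3 \<Rightarrow> vec3 \<Rightarrow> hat) \<Rightarrow> conn \<Rightarrow> bool" where
  "hermitian_conn k h N \<longleftrightarrow>
     (\<forall>d \<in> lie_g k. \<forall>X \<in> vfields k. \<forall>Y \<in> vfields k.
        d (h X Y) = h (N (der_star k d, X)) Y \<oplus>\<^bsub>hat_alg k\<^esub> h X (N (d, Y)))"

definition torsion_free :: "real \<Rightarrow> conn \<Rightarrow> bool" where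
  "torsion_free k N \<longleftrightarrow> N (hat_d k, Phibar k) = N (hat_dbar k, Phi k)"

definition almost_complex :: "real \<Rightarrow> conn \<Rightarrow> bool" where
  "almost_complex k N \<longleftrightarrow>
     (\<forall>d \<in> lie_g k. \<forall>X \<in> vfields k. N (d, Jmap k X) = Jmap k (N (d, X)))"

end

theory Submission
  imports Defs
begin

text \<open>
  In coordinates \<open>X = \<Phi> a + \<Phi>' b\<close>, with \<open>\<Phi>'\<close> for $\bar\Phi$, compatibility with \<open>J\<close> forces
  \<open>\<nabla>\<^sub>d\<close> to preserve the two summands, so that the two sides of the torsion equation lie in complementary
  summands and both vanish. The hermitian condition on \<open>(\<Phi>, \<Phi>)\<close> for \<open>\<partial>\<close> and on \<open>(\<Phi>', \<Phi>')\<close> for the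
  conjugate derivation then leaves no choice for the other two values. Conversely these four values
  extend by the Leibniz rule, and the hermitian condition follows from \<open>S* = S\<close>, \<open>T* = T\<close>.

  The involution and the derivations of the localization exist because an involution is a homomorphism
  into the conjugate opposite algebra and a derivation is a homomorphism into the dual numbers, so
  the universal property applies to both.
\<close>

section \<open>Complex algebras and their homomorphisms\<close>

text \<open>The involutions, the derivations, the symbol map and \<open>J\<close> are definite
  descriptions, so nothing can be computed with them before existence and uniqueness are proved. The
  longest chain leads to \<open>hat_star\<close>: extending the involution to the localization
  requires that the inverted set be stable under it, hence that the symbol map intertwine it with
  complex conjugation, hence that the symbol map exist. That existence cannot be read off the
  presentation: \<open>cat_Z k\<close> is a subalgebra of an algebra given by relations, and which
  relations hold among its generators is not visible from those of the whole algebra. A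
  representation of the whole algebra by operators on functions of a real variable settles it.
  Coordinates of vector fields are unique because \<open>S\<close> and \<open>T\<close> are
  invertible: pairing with the two generators recovers them.\<close>

locale calgebra = ring A for A :: "'a calg" (structure) +
  assumes smult_closed [simp, intro]: "a \<in> carrier A \<Longrightarrow> c \<odot> a \<in> carrier A"
    and smult_add_right: "a \<in> carrier A \<Longrightarrow> b \<in> carrier A \<Longrightarrow> c \<odot> (a \<oplus> b) = c \<odot> a \<oplus> c \<odot> b"
    and smult_add_left: "a \<in> carrier A \<Longrightarrow> (c + c') \<odot> a = c \<odot> a \<oplus> c' \<odot> a"
    and smult_smult: "a \<in> carrier A \<Longrightarrow> c \<odot> (c' \<odot> a) = (c * c') \<odot> a"
    and smult_one: "a \<in> carrier A \<Longrightarrow> 1 \<odot> a = a"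
    and mult_smult_left: "a \<in> carrier A \<Longrightarrow> b \<in> carrier A \<Longrightarrow> (c \<odot> a) \<otimes> b = c \<odot> (a \<otimes> b)"
    and mult_smult_right: "a \<in> carrier A \<Longrightarrow> b \<in> carrier A \<Longrightarrow> a \<otimes> (c \<odot> b) = c \<odot> (a \<otimes> b)"
begin

lemma smult_0_left: "a \<in> carrier A \<Longrightarrow> 0 \<odot> a = \<zero>"
  using smult_add_left[of a 0 0] by (metis add.l_cancel_one' add_0 smult_closed)

lemma smult_0_right: "c \<odot> \<zero> = \<zero>"
  using smult_0_left[of \<zero>] smult_smult[of \<zero> c 0] by simp

lemma a_inv_eq_smult: "a \<in> carrier A \<Longrightarrow> \<ominus> a = (- 1) \<odot> a"
proof -
  assume a: "a \<in> carrier A"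
  then have "(- 1) \<odot> a \<oplus> a = \<zero>"
    using smult_add_left[of a "- 1" 1] by (simp add: smult_0_left smult_one)
  with a show ?thesis
    by (intro minus_equality) simp_all
qed

lemma smult_minus: "a \<in> carrier A \<Longrightarrow> (- c) \<odot> a = \<ominus> (c \<odot> a)"
  by (simp add: a_inv_eq_smult smult_smult)

lemma smult_minus_right: "a \<in> carrier A \<Longrightarrow> c \<odot> (\<ominus> a) = \<ominus> (c \<odot> a)"
  by (simp add: a_inv_eq_smult smult_smult)

lemmas smult_simps = smult_add_right smult_smult smult_one mult_smult_left mult_smult_right
  smult_0_left smult_0_right

end

text \<open>Additive inverses come from the scalar -1, so a candidate algebra needs no negation
  operation of its own.\<close>

lemma calgebraI:
  fixes A :: "'a calg" (structure)
  assumes closed: "\<And>a b. a \<in> carrier A \<Longrightarrow> b \<in> carrier A \<Longrightarrow> a \<oplus> b \<in> carrier A"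
      "\<And>a b. a \<in> carrier A \<Longrightarrow> b \<in> carrier A \<Longrightarrow> a \<otimes> b \<in> carrier A"
      "\<zero> \<in> carrier A" "\<one> \<in> carrier A" "\<And>a c. a \<in> carrier A \<Longrightarrow> c \<odot> a \<in> carrier A"
    and a_assoc: "\<And>a b c. a \<in> carrier A \<Longrightarrow> b \<in> carrier A \<Longrightarrow> c \<in> carrier A \<Longrightarrow>
      (a \<oplus> b) \<oplus> c = a \<oplus> (b \<oplus> c)"
    and a_comm: "\<And>a b. a \<in> carrier A \<Longrightarrow> b \<in> carrier A \<Longrightarrow> a \<oplus> b = b \<oplus> a"
    and l_zero: "\<And>a. a \<in> carrier A \<Longrightarrow> \<zero> \<oplus> a = a"
    and l_minus: "\<And>a. a \<in> carrier A \<Longrightarrow> (- 1) \<odot> a \<oplus> a = \<zero>"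
    and m_assoc: "\<And>a b c. a \<in> carrier A \<Longrightarrow> b \<in> carrier A \<Longrightarrow> c \<in> carrier A \<Longrightarrow>
      (a \<otimes> b) \<otimes> c = a \<otimes> (b \<otimes> c)"
    and l_one: "\<And>a. a \<in> carrier A \<Longrightarrow> \<one> \<otimes> a = a"
    and r_one: "\<And>a. a \<in> carrier A \<Longrightarrow> a \<otimes> \<one> = a"
    and l_distr: "\<And>a b c. a \<in> carrier A \<Longrightarrow> b \<in> carrier A \<Longrightarrow> c \<in> carrier A \<Longrightarrow>
      (a \<oplus> b) \<otimes> c = a \<otimes> c \<oplus> b \<otimes> c"
    and r_distr: "\<And>a b c. a \<in> carrier A \<Longrightarrow> b \<in> carrier A \<Longrightarrow> c \<in> carrier A \<Longrightarrow>
      c \<otimes> (a \<oplus> b) = c \<otimes> a \<oplus> c \<otimes> b"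
    and smult: "\<And>a b c. a \<in> carrier A \<Longrightarrow> b \<in> carrier A \<Longrightarrow> c \<odot> (a \<oplus> b) = c \<odot> a \<oplus> c \<odot> b"
      "\<And>a c c'. a \<in> carrier A \<Longrightarrow> (c + c') \<odot> a = c \<odot> a \<oplus> c' \<odot> a"
      "\<And>a c c'. a \<in> carrier A \<Longrightarrow> c \<odot> (c' \<odot> a) = (c * c') \<odot> a"
      "\<And>a. a \<in> carrier A \<Longrightarrow> 1 \<odot> a = a"
      "\<And>a b c. a \<in> carrier A \<Longrightarrow> b \<in> carrier A \<Longrightarrow> (c \<odot> a) \<otimes> b = c \<odot> (a \<otimes> b)"
      "\<And>a b c. a \<in> carrier A \<Longrightarrow> b \<in> carrier A \<Longrightarrow> a \<otimes> (c \<odot> b) = c \<odot> (a \<otimes> b)"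
  shows "calgebra A"
proof -
  have "abelian_group A"
    by (rule abelian_groupI; (rule closed a_assoc a_comm l_zero | rule bexI, rule l_minus)?)
      (auto intro: closed)
  moreover have "monoid A"
    by (rule monoidI; rule closed m_assoc l_one r_one)
  ultimately have "ring A"
    by (rule ringI) (simp_all add: l_distr r_distr)
  then show ?thesis
    unfolding calgebra_def calgebra_axioms_def by (simp add: closed smult)
qed

lemma alg_homD:
  assumes "alg_hom A B f"
  shows "\<And>a. a \<in> carrier A \<Longrightarrow> f a \<in> carrier B"
    and "\<And>a b. a \<in> carrier A \<Longrightarrow> b \<in> carrier A \<Longrightarrow> f (a \<oplus>\<^bsub>A\<^esub> b) = f a \<oplus>\<^bsub>B\<^esub> f b"
    and "\<And>a b. a \<in> carrier A \<Longrightarrow> b \<in> carrier A \<Longrightarrow> f (a \<otimes>\<^bsub>A\<^esub> b) = f a \<otimes>\<^bsub>B\<^esub> f b"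
    and "f \<one>\<^bsub>A\<^esub> = \<one>\<^bsub>B\<^esub>"
    and "\<And>a c. a \<in> carrier A \<Longrightarrow> f (c \<odot>\<^bsub>A\<^esub> a) = c \<odot>\<^bsub>B\<^esub> f a"
  using assms unfolding alg_hom_def ring_hom_def by auto

lemma alg_homI:
  assumes "\<And>a. a \<in> carrier A \<Longrightarrow> f a \<in> carrier B"
    and "\<And>a b. a \<in> carrier A \<Longrightarrow> b \<in> carrier A \<Longrightarrow> f (a \<oplus>\<^bsub>A\<^esub> b) = f a \<oplus>\<^bsub>B\<^esub> f b"
    and "\<And>a b. a \<in> carrier A \<Longrightarrow> b \<in> carrier A \<Longrightarrow> f (a \<otimes>\<^bsub>A\<^esub> b) = f a \<otimes>\<^bsub>B\<^esub> f b"
    and "f \<one>\<^bsub>A\<^esub> = \<one>\<^bsub>B\<^esub>"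
    and "\<And>a c. a \<in> carrier A \<Longrightarrow> f (c \<odot>\<^bsub>A\<^esub> a) = c \<odot>\<^bsub>B\<^esub> f a"
  shows "alg_hom A B f"
  using assms unfolding alg_hom_def ring_hom_def by auto

lemma alg_hom_id: "alg_hom A A (\<lambda>a. a)"
  by (rule alg_homI) auto

lemma alg_hom_comp: "alg_hom A B f \<Longrightarrow> alg_hom B C g \<Longrightarrow> alg_hom A C (\<lambda>a. g (f a))"
  by (rule alg_homI) (auto simp: alg_homD)

lemma alg_hom_zero:
  assumes "calgebra A" "calgebra B" "alg_hom A B f"
  shows "f \<zero>\<^bsub>A\<^esub> = \<zero>\<^bsub>B\<^esub>"
proof -
  interpret A: calgebra A by fact
  interpret B: calgebra B by fact
  show ?thesis
    using alg_homD(5)[OF assms(3), of "\<zero>\<^bsub>A\<^esub>" 0] alg_homD(1)[OF assms(3), of "\<zero>\<^bsub>A\<^esub>"]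
    by (simp add: A.smult_simps B.smult_simps)
qed

text \<open>Both values at \<open>y\<close> are two-sided inverses of the same element. This is what
  makes values at formal inverses, and at the inverses of \<open>R\<close> and \<open>W\<close>,
  automatic in every uniqueness proof below.\<close>

lemma alg_hom_inverse_cong:
  assumes "monoid B" "alg_hom A B f" "alg_hom A B g"
    and "x \<in> carrier A" "y \<in> carrier A" "x \<otimes>\<^bsub>A\<^esub> y = \<one>\<^bsub>A\<^esub>" "y \<otimes>\<^bsub>A\<^esub> x = \<one>\<^bsub>A\<^esub>" "f x = g x"
  shows "f y = g y"
proof -
  interpret monoid B by fact
  have "f y \<otimes>\<^bsub>B\<^esub> f x = \<one>\<^bsub>B\<^esub>" "f x \<otimes>\<^bsub>B\<^esub> g y = \<one>\<^bsub>B\<^esub>"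
    using assms alg_homD[OF assms(2)] alg_homD[OF assms(3)] by metis+
  then show ?thesis
    using assms alg_homD[OF assms(2)] alg_homD[OF assms(3)] by (metis inv_unique)
qed

section \<open>Generators and relations\<close>

primrec aeval :: "'a calg \<Rightarrow> ('g \<Rightarrow> 'a) \<Rightarrow> 'g aterm \<Rightarrow> 'a" where
  "aeval A f (Gen g) = f g"
| "aeval A f (Scalar c) = c \<odot>\<^bsub>A\<^esub> \<one>\<^bsub>A\<^esub>"
| "aeval A f (s \<boxplus> t) = aeval A f s \<oplus>\<^bsub>A\<^esub> aeval A f t"
| "aeval A f (s \<boxtimes> t) = aeval A f s \<otimes>\<^bsub>A\<^esub> aeval A f t"

lemma (in calgebra) aeval_closed: "(\<And>g. f g \<in> carrier A) \<Longrightarrow> aeval A f t \<in> carrier A"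
  by (induction t) auto

lemma (in calgebra) aeval_acong:
  assumes "acong Rel s t" "\<And>g. f g \<in> carrier A"
    and "\<And>s t. (s, t) \<in> Rel \<Longrightarrow> aeval A f s = aeval A f t"
  shows "aeval A f s = aeval A f t"
proof -
  have ev: "aeval A f t \<in> carrier A" for t
    using aeval_closed assms(2) by blast
  show ?thesis
    using assms(1)
  proof induction
    case (plus_inverse t)
    show ?case
      using ev[of t] by (simp add: smult_simps l_minus l_neg flip: a_inv_eq_smult)
  qed (use assms in \<open>auto simp: ev smult_simps smult_add_left a_ac m_assoc l_distr r_distr
        mult.commute\<close>)
qed

lemma acls_eq_iff: "acls Rel s = acls Rel t \<longleftrightarrow> acong Rel s t"
  unfolding acls_def by (blast intro: acong.refl acong.sym acong.trans)

lemma acls_self: "t \<in> acls Rel t"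
  by (simp add: acls_def acong.refl)

text \<open>The operations of \<open>presented_alg\<close> are unions over all representatives; when
  the term operation respects the congruence, every member of the union is the same class.\<close>

lemma acls_UN:
  assumes "\<And>p. acong Rel t p \<Longrightarrow> acong Rel (F t) (F p)"
  shows "(\<Union>p\<in>acls Rel t. acls Rel (F p)) = acls Rel (F t)"
  unfolding acls_def using assms by (blast intro: acong.refl acong.sym acong.trans)

lemma presented_alg_simps:
  "acls Rel s \<otimes>\<^bsub>presented_alg X Rel\<^esub> acls Rel t = acls Rel (s \<boxtimes> t)"
  "acls Rel s \<oplus>\<^bsub>presented_alg X Rel\<^esub> acls Rel t = acls Rel (s \<boxplus> t)"
  "c \<odot>\<^bsub>presented_alg X Rel\<^esub> acls Rel t = acls Rel (Scalar c \<boxtimes> t)"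
  "\<zero>\<^bsub>presented_alg X Rel\<^esub> = acls Rel (Scalar 0)"
  "\<one>\<^bsub>presented_alg X Rel\<^esub> = acls Rel (Scalar 1)"
  unfolding presented_alg_def
  by (simp_all add: acls_UN acong.plus_cong acong.times_cong acong.refl)

lemma presented_alg_carrier: "carrier (presented_alg X Rel) = {acls Rel t | t. gens t \<subseteq> X}"
  by (simp add: presented_alg_def)

lemma presented_alg_gen: "g \<in> X \<Longrightarrow> acls Rel (Gen g) \<in> carrier (presented_alg X Rel)"
  unfolding presented_alg_carrier by force

lemma calgebra_presented_alg: "calgebra (presented_alg X Rel)"
proof (rule calgebraI)
  let ?P = "presented_alg X Rel"
  have cl: "acls Rel t \<in> carrier ?P" if "gens t \<subseteq> X" for t
    using that by (auto simp: presented_alg_carrier)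
  note simps = presented_alg_simps acls_eq_iff
  show "\<zero>\<^bsub>?P\<^esub> \<in> carrier ?P" "\<one>\<^bsub>?P\<^esub> \<in> carrier ?P"
    by (simp_all add: simps cl)
  fix a assume "a \<in> carrier ?P"
  then obtain s where s: "a = acls Rel s" "gens s \<subseteq> X"
    by (auto simp: presented_alg_carrier)
  show "\<zero>\<^bsub>?P\<^esub> \<oplus>\<^bsub>?P\<^esub> a = a" "\<one>\<^bsub>?P\<^esub> \<otimes>\<^bsub>?P\<^esub> a = a" "a \<otimes>\<^bsub>?P\<^esub> \<one>\<^bsub>?P\<^esub> = a"
    "1 \<odot>\<^bsub>?P\<^esub> a = a" "(- 1) \<odot>\<^bsub>?P\<^esub> a \<oplus>\<^bsub>?P\<^esub> a = \<zero>\<^bsub>?P\<^esub>"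
    by (simp_all add: s simps acong.plus_zero acong.one_times acong.times_one acong.plus_inverse)
  show "c \<odot>\<^bsub>?P\<^esub> a \<in> carrier ?P" for c
    using s(2) by (simp add: s(1) simps cl)
  show "(c + c') \<odot>\<^bsub>?P\<^esub> a = c \<odot>\<^bsub>?P\<^esub> a \<oplus>\<^bsub>?P\<^esub> c' \<odot>\<^bsub>?P\<^esub> a"
    "c \<odot>\<^bsub>?P\<^esub> (c' \<odot>\<^bsub>?P\<^esub> a) = (c * c') \<odot>\<^bsub>?P\<^esub> a" for c c'
    unfolding s simps
    by (rule acong.trans[OF acong.times_cong[OF acong.scalar_plus acong.refl] acong.distrib_right]
        acong.trans[OF acong.sym[OF acong.times_assoc]
          acong.times_cong[OF acong.sym[OF acong.scalar_times] acong.refl]])+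
  fix b assume "b \<in> carrier ?P"
  then obtain t where t: "b = acls Rel t" "gens t \<subseteq> X"
    by (auto simp: presented_alg_carrier)
  show "a \<oplus>\<^bsub>?P\<^esub> b \<in> carrier ?P" "a \<otimes>\<^bsub>?P\<^esub> b \<in> carrier ?P"
    using s(2) t(2) by (simp_all add: s(1) t(1) simps cl)
  show "a \<oplus>\<^bsub>?P\<^esub> b = b \<oplus>\<^bsub>?P\<^esub> a"
    unfolding s t simps by (rule acong.plus_comm)
  show "c \<odot>\<^bsub>?P\<^esub> (a \<oplus>\<^bsub>?P\<^esub> b) = c \<odot>\<^bsub>?P\<^esub> a \<oplus>\<^bsub>?P\<^esub> c \<odot>\<^bsub>?P\<^esub> b" for c
    unfolding s t simps by (rule acong.distrib_left)
  show *: "(c \<odot>\<^bsub>?P\<^esub> a) \<otimes>\<^bsub>?P\<^esub> b = c \<odot>\<^bsub>?P\<^esub> (a \<otimes>\<^bsub>?P\<^esub> b)" for c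
    unfolding s t simps by (rule acong.times_assoc)
  have "acong Rel (s \<boxtimes> (Scalar c \<boxtimes> t)) ((Scalar c \<boxtimes> s) \<boxtimes> t)" for c
    by (rule acong.trans[OF acong.sym[OF acong.times_assoc]
          acong.times_cong[OF acong.sym[OF acong.scalar_central] acong.refl]])
  then show "a \<otimes>\<^bsub>?P\<^esub> (c \<odot>\<^bsub>?P\<^esub> b) = c \<odot>\<^bsub>?P\<^esub> (a \<otimes>\<^bsub>?P\<^esub> b)" for c
    unfolding *[symmetric] unfolding s t simps .
  fix c assume "c \<in> carrier ?P"
  then obtain u where u: "c = acls Rel u" "gens u \<subseteq> X"
    by (auto simp: presented_alg_carrier)
  show "(a \<oplus>\<^bsub>?P\<^esub> b) \<oplus>\<^bsub>?P\<^esub> c = a \<oplus>\<^bsub>?P\<^esub> (b \<oplus>\<^bsub>?P\<^esub> c)"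
    "(a \<otimes>\<^bsub>?P\<^esub> b) \<otimes>\<^bsub>?P\<^esub> c = a \<otimes>\<^bsub>?P\<^esub> (b \<otimes>\<^bsub>?P\<^esub> c)"
    "(a \<oplus>\<^bsub>?P\<^esub> b) \<otimes>\<^bsub>?P\<^esub> c = a \<otimes>\<^bsub>?P\<^esub> c \<oplus>\<^bsub>?P\<^esub> b \<otimes>\<^bsub>?P\<^esub> c"
    "c \<otimes>\<^bsub>?P\<^esub> (a \<oplus>\<^bsub>?P\<^esub> b) = c \<otimes>\<^bsub>?P\<^esub> a \<oplus>\<^bsub>?P\<^esub> c \<otimes>\<^bsub>?P\<^esub> b"
    unfolding s t u simps
    by (rule acong.plus_assoc acong.times_assoc acong.distrib_right acong.distrib_left)+
qed

text \<open>Values in \<open>B\<close> are required at every generator, also outside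
  \<open>X\<close>: a class contains terms with foreign generators, and the representative picked by
  \<open>SOME\<close> may be one of them.\<close>

theorem presented_alg_hom_exists:
  assumes "calgebra B" "\<And>g. f g \<in> carrier B"
    and "\<And>s t. (s, t) \<in> Rel \<Longrightarrow> aeval B f s = aeval B f t"
  shows "\<exists>F. alg_hom (presented_alg X Rel) B F \<and> (\<forall>g \<in> X. F (acls Rel (Gen g)) = f g)"
proof -
  interpret calgebra B by fact
  define F where "F P = aeval B f (SOME t. t \<in> P)" for P
  have F: "F (acls Rel t) = aeval B f t" for t
  proof -
    have "acong Rel t (SOME s. s \<in> acls Rel t)"
      using someI[of "\<lambda>s. s \<in> acls Rel t", OF acls_self] by (simp add: acls_def)
    then show ?thesis
      unfolding F_def using aeval_acong assms(2,3) by metis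
  qed
  have "alg_hom (presented_alg X Rel) B F"
    by (rule alg_homI)
      (auto simp: presented_alg_carrier presented_alg_simps F aeval_closed assms(2) smult_simps)
  then show ?thesis
    using F by force
qed

theorem presented_alg_hom_unique:
  assumes F: "alg_hom (presented_alg X Rel) B F" and G: "alg_hom (presented_alg X Rel) B G"
    and gen: "\<And>g. g \<in> X \<Longrightarrow> F (acls Rel (Gen g)) = G (acls Rel (Gen g))"
    and a: "a \<in> carrier (presented_alg X Rel)"
  shows "F a = G a"
proof -
  let ?P = "presented_alg X Rel"
  have cl: "acls Rel t \<in> carrier ?P" if "gens t \<subseteq> X" for t
    using that by (auto simp: presented_alg_carrier)
  have "gens t \<subseteq> X \<Longrightarrow> F (acls Rel t) = G (acls Rel t)" for t
  proof (induction t)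
    case (Scalar c)
    \<comment> \<open>Constants need no hypothesis, because homomorphisms are linear and preserve
      the unit.\<close>
    have "acls Rel (Scalar c) = c \<odot>\<^bsub>?P\<^esub> \<one>\<^bsub>?P\<^esub>"
      by (simp add: presented_alg_simps acls_eq_iff acong.intros)
    then show ?case
      using alg_homD[OF F] alg_homD[OF G] calgebra_presented_alg[of X Rel]
      by (simp add: calgebra_def ring.ring_simprules)
  next
    case (Plus s t)
    then show ?case
      using alg_homD(2)[OF F cl cl, of s t] alg_homD(2)[OF G cl cl, of s t]
      by (simp add: presented_alg_simps)
  next
    case (Times s t)
    then show ?case
      using alg_homD(3)[OF F cl cl, of s t] alg_homD(3)[OF G cl cl, of s t]
      by (simp add: presented_alg_simps)
  qed (use gen in auto)
  then show ?thesis
    using a by (auto simp: presented_alg_carrier)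
qed

section \<open>Localization\<close>

lemma calgebra_localization: "calgebra (localization A \<Sigma>)"
  unfolding localization_def by (rule calgebra_presented_alg)

lemma loc_map_hom: "alg_hom A (localization A \<Sigma>) (loc_map A \<Sigma>)"
  by (rule alg_homI) (auto simp: localization_def loc_map_def presented_alg_simps acls_eq_iff
      intro: presented_alg_gen acong.rel loc_rels.intros)

lemma loc_map_inverse:
  fixes A :: "'a calg"
  assumes "z \<in> \<Sigma>"
  defines "y \<equiv> acls (loc_rels A \<Sigma>) (Gen (FormalInv z))"
  shows "y \<in> carrier (localization A \<Sigma>)"
    and "loc_map A \<Sigma> z \<otimes>\<^bsub>localization A \<Sigma>\<^esub> y = \<one>\<^bsub>localization A \<Sigma>\<^esub>"
    and "y \<otimes>\<^bsub>localization A \<Sigma>\<^esub> loc_map A \<Sigma> z = \<one>\<^bsub>localization A \<Sigma>\<^esub>"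
  unfolding localization_def loc_map_def y_def presented_alg_simps acls_eq_iff
  by (rule presented_alg_gen acong.rel loc_rels.intros UnI2 imageI assms)+

lemma loc_map_Units:
  assumes "z \<in> \<Sigma>" "\<Sigma> \<subseteq> carrier A"
  shows "loc_map A \<Sigma> z \<in> Units (localization A \<Sigma>)"
proof -
  have "loc_map A \<Sigma> z \<in> carrier (localization A \<Sigma>)"
    using assms by (auto intro: alg_homD(1)[OF loc_map_hom])
  then show ?thesis
    unfolding Units_def using loc_map_inverse[OF assms(1), of A] by (auto intro: bexI)
qed

theorem localization_hom_exists:
  assumes "calgebra A" "calgebra B" "\<Sigma> \<subseteq> carrier A" "alg_hom A B F"
    and units: "\<And>z. z \<in> \<Sigma> \<Longrightarrow> F z \<in> Units B"
  shows "\<exists>G. alg_hom (localization A \<Sigma>) B G \<and> (\<forall>a \<in> carrier A. G (loc_map A \<Sigma> a) = F a)"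
proof -
  interpret A: calgebra A by fact
  interpret B: calgebra B by fact
  note F = alg_homD[OF assms(4)]
  \<comment> \<open>The default value zero only serves to keep \<open>f\<close> inside
    \<open>B\<close> at elements that are not generators of the localization.\<close>
  define f where "f g = (case g of Elem a \<Rightarrow> if a \<in> carrier A then F a else \<zero>\<^bsub>B\<^esub>
    | FormalInv z \<Rightarrow> if z \<in> \<Sigma> then inv\<^bsub>B\<^esub> (F z) else \<zero>\<^bsub>B\<^esub>)" for g
  have "f g \<in> carrier B" for g
    using F(1) units by (auto simp: f_def split: locgen.split)
  moreover have "aeval B f s = aeval B f t" if "(s, t) \<in> loc_rels A \<Sigma>" for s t
    using that assms(3) units
    by cases (auto simp: f_def F B.smult_simps)
  ultimately obtain G where "alg_hom (localization A \<Sigma>) B G"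
    and "\<forall>g \<in> Elem ` carrier A \<union> FormalInv ` \<Sigma>. G (acls (loc_rels A \<Sigma>) (Gen g)) = f g"
    unfolding localization_def using presented_alg_hom_exists[OF assms(2)] by blast
  then show ?thesis
    by (intro exI[of _ G]) (auto simp: loc_map_def f_def)
qed

text \<open>The image of \<open>A\<close> does not generate the localization, but the remaining
  generators are inverses of elements of that image, so their values are forced as well.\<close>

theorem localization_hom_unique:
  assumes "calgebra B" "\<Sigma> \<subseteq> carrier A"
    and F: "alg_hom (localization A \<Sigma>) B F" and G: "alg_hom (localization A \<Sigma>) B G"
    and eq: "\<And>a. a \<in> carrier A \<Longrightarrow> F (loc_map A \<Sigma> a) = G (loc_map A \<Sigma> a)"
    and x: "x \<in> carrier (localization A \<Sigma>)"
  shows "F x = G x"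
proof -
  interpret B: calgebra B by fact
  have "F (acls (loc_rels A \<Sigma>) (Gen g)) = G (acls (loc_rels A \<Sigma>) (Gen g))"
    if g: "g \<in> Elem ` carrier A \<union> FormalInv ` \<Sigma>" for g
  proof (cases g)
    case (Elem a)
    then show ?thesis
      using g eq by (auto simp: loc_map_def)
  next
    case (FormalInv z)
    then have z: "z \<in> \<Sigma>"
      using g by auto
    then have zc: "z \<in> carrier A"
      using assms(2) by auto
    show ?thesis
      unfolding FormalInv
      by (rule alg_hom_inverse_cong[OF B.monoid_axioms F G alg_homD(1)[OF loc_map_hom zc]
            loc_map_inverse[OF z] eq[OF zc]])
  qed
  then show ?thesis
    using presented_alg_hom_unique[OF F[unfolded localization_def] G[unfolded localization_def] _
        x[unfolded localization_def]] by blast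
qed

section \<open>Derivations as homomorphisms into the dual numbers\<close>

text \<open>The pair \<open>(a, a')\<close> stands for a + \<epsilon> a' with \<epsilon> central and
  of square zero.\<close>

definition dual_alg :: "'a calg \<Rightarrow> ('a \<times> 'a) calg" where
  "dual_alg A =
     \<lparr>carrier = carrier A \<times> carrier A,
      mult = (\<lambda>x y. (fst x \<otimes>\<^bsub>A\<^esub> fst y, (snd x \<otimes>\<^bsub>A\<^esub> fst y) \<oplus>\<^bsub>A\<^esub> (fst x \<otimes>\<^bsub>A\<^esub> snd y))),
      one = (\<one>\<^bsub>A\<^esub>, \<zero>\<^bsub>A\<^esub>), zero = (\<zero>\<^bsub>A\<^esub>, \<zero>\<^bsub>A\<^esub>),
      add = (\<lambda>x y. (fst x \<oplus>\<^bsub>A\<^esub> fst y, snd x \<oplus>\<^bsub>A\<^esub> snd y)),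
      smult = (\<lambda>c x. (c \<odot>\<^bsub>A\<^esub> fst x, c \<odot>\<^bsub>A\<^esub> snd x))\<rparr>"

lemma dual_alg_simps:
  "carrier (dual_alg A) = carrier A \<times> carrier A"
  "x \<otimes>\<^bsub>dual_alg A\<^esub> y =
     (fst x \<otimes>\<^bsub>A\<^esub> fst y, (snd x \<otimes>\<^bsub>A\<^esub> fst y) \<oplus>\<^bsub>A\<^esub> (fst x \<otimes>\<^bsub>A\<^esub> snd y))"
  "x \<oplus>\<^bsub>dual_alg A\<^esub> y = (fst x \<oplus>\<^bsub>A\<^esub> fst y, snd x \<oplus>\<^bsub>A\<^esub> snd y)"
  "\<one>\<^bsub>dual_alg A\<^esub> = (\<one>\<^bsub>A\<^esub>, \<zero>\<^bsub>A\<^esub>)" "\<zero>\<^bsub>dual_alg A\<^esub> = (\<zero>\<^bsub>A\<^esub>, \<zero>\<^bsub>A\<^esub>)"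
  "c \<odot>\<^bsub>dual_alg A\<^esub> x = (c \<odot>\<^bsub>A\<^esub> fst x, c \<odot>\<^bsub>A\<^esub> snd x)"
  by (simp_all add: dual_alg_def)

lemma (in calgebra) calgebra_dual_alg: "calgebra (dual_alg A)"
proof -
  have neg: "a \<oplus> (- 1) \<odot> a = \<zero>" if "a \<in> carrier A" for a
    using that by (simp add: r_neg flip: a_inv_eq_smult)
  show ?thesis
    by (rule calgebraI) (auto simp: dual_alg_simps smult_simps smult_add_left a_ac m_assoc l_distr
        r_distr neg)
qed

text \<open>The inverse of x + \<epsilon> x' is y - \<epsilon> y x' y with y the inverse of x. The
  second component is the rule for differentiating an inverse, and it is the reason why a derivation
  extends to a localization.\<close>

lemma (in calgebra) dual_alg_Units:
  assumes "x \<in> Units A" "x' \<in> carrier A"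
  shows "(x, x') \<in> Units (dual_alg A)"
proof -
  let ?y = "inv x"
  have x: "x \<in> carrier A" "?y \<in> carrier A" "x \<otimes> ?y = \<one>" "?y \<otimes> x = \<one>"
    using assms by auto
  have xy: "x \<otimes> (?y \<otimes> a) = a" "?y \<otimes> (x \<otimes> a) = a" if "a \<in> carrier A" for a
    using x that by (simp_all flip: m_assoc)
  show ?thesis
    unfolding Units_def using x assms(2)
    by (intro CollectI conjI bexI[of _ "(?y, \<ominus> (?y \<otimes> x' \<otimes> ?y))"])
      (simp_all add: dual_alg_simps r_minus l_minus m_assoc xy r_neg l_neg)
qed

lemma derivationD:
  assumes "derivation A d"
  shows "d \<in> carrier A \<rightarrow>\<^sub>E carrier A"
    and "\<And>a. a \<in> carrier A \<Longrightarrow> d a \<in> carrier A"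
    and "\<And>a b. a \<in> carrier A \<Longrightarrow> b \<in> carrier A \<Longrightarrow> d (a \<oplus>\<^bsub>A\<^esub> b) = d a \<oplus>\<^bsub>A\<^esub> d b"
    and "\<And>a c. a \<in> carrier A \<Longrightarrow> d (c \<odot>\<^bsub>A\<^esub> a) = c \<odot>\<^bsub>A\<^esub> d a"
    and "\<And>a b. a \<in> carrier A \<Longrightarrow> b \<in> carrier A \<Longrightarrow>
      d (a \<otimes>\<^bsub>A\<^esub> b) = (d a \<otimes>\<^bsub>A\<^esub> b) \<oplus>\<^bsub>A\<^esub> (a \<otimes>\<^bsub>A\<^esub> d b)"
  using assms unfolding derivation_def by auto

lemma derivation_eqI:
  assumes "derivation A d" "derivation A e" "\<And>a. a \<in> carrier A \<Longrightarrow> d a = e a"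
  shows "d = e"
  using derivationD(1)[OF assms(1)] derivationD(1)[OF assms(2)] assms(3) by (rule PiE_ext)

lemma (in calgebra) derivation_one:
  assumes "derivation A d"
  shows "d \<one> = \<zero>"
proof -
  have "d \<one> = d \<one> \<oplus> d \<one>"
    using derivationD(5)[OF assms, of \<one> \<one>] derivationD(2)[OF assms, of \<one>] by simp
  then show ?thesis
    using derivationD(2)[OF assms, of \<one>] by (metis add.l_cancel_one' one_closed)
qed

lemma (in calgebra) derivation_hom:
  assumes "derivation A d"
  shows "alg_hom A (dual_alg A) (\<lambda>a. (a, d a))"
  by (rule alg_homI) (use derivationD[OF assms] derivation_one[OF assms] in \<open>simp_all add: dual_alg_simps\<close>)

text \<open>With the identity as first component, multiplicativity in the second component reads as
  the Leibniz rule.\<close>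

lemma derivation_of_hom:
  assumes "calgebra A" "alg_hom A (dual_alg A) F" "\<And>a. a \<in> carrier A \<Longrightarrow> fst (F a) = a"
  shows "derivation A (\<lambda>a \<in> carrier A. snd (F a))"
proof -
  interpret calgebra A by fact
  note F = alg_homD[OF assms(2)]
  have "snd (F a) \<in> carrier A" if "a \<in> carrier A" for a
    using F(1)[OF that] by (auto simp: dual_alg_simps)
  then show ?thesis
    unfolding derivation_def by (simp add: F dual_alg_simps assms(3))
qed

lemma alg_hom_fst_dual_alg: "alg_hom (dual_alg A) A fst"
  by (rule alg_homI) (auto simp: dual_alg_simps)

lemma alg_hom_map_dual_alg:
  assumes "calgebra A" "calgebra B" "alg_hom A B f"
  shows "alg_hom (dual_alg A) (dual_alg B) (map_prod f f)"
proof -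
  interpret calgebra A by fact
  show ?thesis
    by (rule alg_homI)
      (auto simp: dual_alg_simps alg_homD[OF assms(3)] alg_hom_zero[OF assms])
qed

theorem ex1_derivation_localization:
  assumes "calgebra A" "\<Sigma> \<subseteq> carrier A" "derivation A d"
  shows "\<exists>!D. derivation (localization A \<Sigma>) D \<and>
    (\<forall>a \<in> carrier A. D (loc_map A \<Sigma> a) = loc_map A \<Sigma> (d a))"
proof -
  let ?L = "localization A \<Sigma>" and ?i = "loc_map A \<Sigma>"
  interpret A: calgebra A by fact
  interpret L: calgebra ?L by (rule calgebra_localization)
  note i = loc_map_hom[of A \<Sigma>]
  have hom: "alg_hom A (dual_alg ?L) (\<lambda>a. (?i a, ?i (d a)))"
    using alg_hom_comp[OF A.derivation_hom[OF assms(3)]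
        alg_hom_map_dual_alg[OF assms(1) L.calgebra_axioms i]] by simp
  have "(?i z, ?i (d z)) \<in> Units (dual_alg ?L)" if "z \<in> \<Sigma>" for z
    using that assms(2) loc_map_Units alg_homD(1)[OF i] derivationD(2)[OF assms(3)]
    by (intro L.dual_alg_Units) auto
  then obtain G where G: "alg_hom ?L (dual_alg ?L) G" "\<forall>a \<in> carrier A. G (?i a) = (?i a, ?i (d a))"
    using localization_hom_exists[OF assms(1) L.calgebra_dual_alg assms(2) hom] by blast
  \<comment> \<open>The first component of \<open>G\<close> is an endomorphism of the localization
    that fixes the image of \<open>A\<close>, hence the identity.\<close>
  have "fst (G x) = x" if "x \<in> carrier ?L" for x
    using localization_hom_unique[OF L.calgebra_axioms assms(2)
        alg_hom_comp[OF G(1) alg_hom_fst_dual_alg] alg_hom_id _ that] G(2) by simp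
  then have "derivation ?L (\<lambda>x \<in> carrier ?L. snd (G x))"
    by (rule derivation_of_hom[OF L.calgebra_axioms G(1)])
  moreover have "(\<lambda>x \<in> carrier ?L. snd (G x)) (?i a) = ?i (d a)" if "a \<in> carrier A" for a
    using that G(2) alg_homD(1)[OF i that] by simp
  moreover have "D = E" if D: "derivation ?L D" "\<forall>a \<in> carrier A. D (?i a) = ?i (d a)"
    and E: "derivation ?L E" "\<forall>a \<in> carrier A. E (?i a) = ?i (d a)" for D E
    using localization_hom_unique[OF L.calgebra_dual_alg assms(2) L.derivation_hom[OF D(1)]
        L.derivation_hom[OF E(1)]] D(2) E(2) by (intro derivation_eqI[OF D(1) E(1)]) auto
  ultimately show ?thesis
    by blast
qed

section \<open>Involutions as homomorphisms into the opposite conjugate algebra\<close>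

definition opc_alg :: "'a calg \<Rightarrow> 'a calg" where
  "opc_alg A = A\<lparr>mult := (\<lambda>a b. b \<otimes>\<^bsub>A\<^esub> a), smult := (\<lambda>c a. cnj c \<odot>\<^bsub>A\<^esub> a)\<rparr>"

lemma opc_alg_simps:
  "carrier (opc_alg A) = carrier A" "x \<otimes>\<^bsub>opc_alg A\<^esub> y = y \<otimes>\<^bsub>A\<^esub> x"
  "x \<oplus>\<^bsub>opc_alg A\<^esub> y = x \<oplus>\<^bsub>A\<^esub> y" "\<one>\<^bsub>opc_alg A\<^esub> = \<one>\<^bsub>A\<^esub>" "\<zero>\<^bsub>opc_alg A\<^esub> = \<zero>\<^bsub>A\<^esub>"
  "c \<odot>\<^bsub>opc_alg A\<^esub> x = cnj c \<odot>\<^bsub>A\<^esub> x"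
  by (simp_all add: opc_alg_def)

lemma opc_alg_Units: "Units (opc_alg A) = Units A"
  by (auto simp: Units_def opc_alg_simps)

lemma (in calgebra) calgebra_opc_alg: "calgebra (opc_alg A)"
proof -
  have neg: "a \<oplus> (- 1) \<odot> a = \<zero>" if "a \<in> carrier A" for a
    using that by (simp add: r_neg flip: a_inv_eq_smult)
  show ?thesis
    by (rule calgebraI) (auto simp: opc_alg_simps smult_simps smult_add_left a_ac m_assoc l_distr
        r_distr neg)
qed

lemma star_involutionD:
  assumes "star_involution A s"
  shows "s \<in> carrier A \<rightarrow>\<^sub>E carrier A"
    and "\<And>a. a \<in> carrier A \<Longrightarrow> s a \<in> carrier A"
    and "\<And>a b. a \<in> carrier A \<Longrightarrow> b \<in> carrier A \<Longrightarrow> s (a \<oplus>\<^bsub>A\<^esub> b) = s a \<oplus>\<^bsub>A\<^esub> s b"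
    and "\<And>a c. a \<in> carrier A \<Longrightarrow> s (c \<odot>\<^bsub>A\<^esub> a) = cnj c \<odot>\<^bsub>A\<^esub> s a"
    and "\<And>a b. a \<in> carrier A \<Longrightarrow> b \<in> carrier A \<Longrightarrow> s (a \<otimes>\<^bsub>A\<^esub> b) = s b \<otimes>\<^bsub>A\<^esub> s a"
    and "\<And>a. a \<in> carrier A \<Longrightarrow> s (s a) = a"
  using assms unfolding star_involution_def by auto

lemma star_involution_eqI:
  assumes "star_involution A s" "star_involution A t" "\<And>a. a \<in> carrier A \<Longrightarrow> s a = t a"
  shows "s = t"
  using star_involutionD(1)[OF assms(1)] star_involutionD(1)[OF assms(2)] assms(3) by (rule PiE_ext)

text \<open>Evaluate \<open>s (\<one> \<otimes> s \<one>)\<close> in two ways: involutivity gives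
  the unit, reversal of the factors gives \<open>s \<one>\<close>.\<close>

lemma (in calgebra) star_involution_one:
  assumes "star_involution A s"
  shows "s \<one> = \<one>"
  using star_involutionD(5)[OF assms, of \<one> "s \<one>"] star_involutionD(2,6)[OF assms, of \<one>]
  by simp

lemma (in calgebra) star_involution_hom:
  assumes "star_involution A s"
  shows "alg_hom A (opc_alg A) s"
  by (rule alg_homI)
    (simp_all add: star_involutionD(2-)[OF assms] star_involution_one[OF assms] opc_alg_simps)

lemma star_involution_of_hom:
  assumes "alg_hom A (opc_alg A) F" "\<And>a. a \<in> carrier A \<Longrightarrow> F (F a) = a" "calgebra A"
  shows "star_involution A (restrict F (carrier A))"
proof -
  interpret calgebra A by fact
  show ?thesis
    using alg_homD[OF assms(1)] assms(2) by (auto simp: star_involution_def opc_alg_simps)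
qed

lemma alg_hom_opc_alg_comp:
  assumes "alg_hom A (opc_alg B) F" "alg_hom B (opc_alg C) G"
  shows "alg_hom A C (\<lambda>a. G (F a))"
  by (rule alg_homI) (use alg_homD[OF assms(1)] alg_homD[OF assms(2)] in \<open>auto simp: opc_alg_simps\<close>)

theorem ex1_star_localization:
  assumes "calgebra A" "\<Sigma> \<subseteq> carrier A" "star_involution A s" "s ` \<Sigma> \<subseteq> \<Sigma>"
  shows "\<exists>!t. star_involution (localization A \<Sigma>) t \<and>
    (\<forall>a \<in> carrier A. t (loc_map A \<Sigma> a) = loc_map A \<Sigma> (s a))"
proof -
  let ?L = "localization A \<Sigma>" and ?i = "loc_map A \<Sigma>"
  interpret A: calgebra A by fact
  interpret L: calgebra ?L by (rule calgebra_localization)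
  note i = loc_map_hom[of A \<Sigma>] and s = star_involutionD[OF assms(3)]
  have hom: "alg_hom A (opc_alg ?L) (\<lambda>a. ?i (s a))"
    by (rule alg_homI)
      (simp_all add: opc_alg_simps alg_homD[OF i] s(2-) A.star_involution_one[OF assms(3)])
  have "?i (s z) \<in> Units (opc_alg ?L)" if "z \<in> \<Sigma>" for z
    using that assms(4) loc_map_Units[OF _ assms(2), of "s z"] by (auto simp: opc_alg_Units)
  then obtain G where G: "alg_hom ?L (opc_alg ?L) G" "\<And>a. a \<in> carrier A \<Longrightarrow> G (?i a) = ?i (s a)"
    using localization_hom_exists[OF assms(1) L.calgebra_opc_alg assms(2) hom] by blast
  \<comment> \<open>Reversing factors and conjugating scalars twice does nothing, so
    \<open>G\<close> composed with itself is an ordinary homomorphism; on the image of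
    \<open>A\<close> it is the identity because \<open>s\<close> is an involution.\<close>
  have "G (G x) = x" if "x \<in> carrier ?L" for x
    using localization_hom_unique[OF L.calgebra_axioms assms(2)
        alg_hom_opc_alg_comp[OF G(1) G(1)] alg_hom_id _ that] by (simp add: G(2) s)
  then have "star_involution ?L (restrict G (carrier ?L))"
    by (rule star_involution_of_hom[OF G(1) _ L.calgebra_axioms])
  moreover have "restrict G (carrier ?L) (?i a) = ?i (s a)" if "a \<in> carrier A" for a
    using that G(2) alg_homD(1)[OF i that] by simp
  moreover have "t = u" if t: "star_involution ?L t" "\<forall>a \<in> carrier A. t (?i a) = ?i (s a)"
    and u: "star_involution ?L u" "\<forall>a \<in> carrier A. u (?i a) = ?i (s a)" for t u
    using localization_hom_unique[OF L.calgebra_opc_alg assms(2) L.star_involution_hom[OF t(1)]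
        L.star_involution_hom[OF u(1)]] t(2) u(2)
    by (intro star_involution_eqI[OF t(1) u(1)]) auto
  ultimately show ?thesis
    by blast
qed

text \<open>The two reversals of factors cancel, as do the two conjugations. A derivation is shown
  to be hermitian below by identifying it with this conjugate, through uniqueness from the values on
  generators.\<close>

lemma derivation_star_conj:
  assumes "calgebra A" "derivation A d" "star_involution A s"
  shows "derivation A (\<lambda>a \<in> carrier A. s (d (s a)))"
proof -
  interpret calgebra A by fact
  show ?thesis
    unfolding derivation_def
    by (auto simp: star_involutionD(2-)[OF assms(3)] derivationD(2-)[OF assms(2)] a_comm)
qed

section \<open>The catenoid algebra\<close>

lemma calgebra_cat_alg: "calgebra (cat_alg k)"
  unfolding cat_alg_def by (rule calgebra_presented_alg)

interpretation cat: calgebra "cat_alg k" for k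
  by (rule calgebra_cat_alg)

lemma cat_gen_closed [simp]: "cat_gen k g \<in> carrier (cat_alg k)"
  by (simp add: cat_gen_def cat_alg_def presented_alg_gen)

lemma cat_gen_rel: "(s, t) \<in> cat_rels k \<Longrightarrow> acls (cat_rels k) s = acls (cat_rels k) t"
  by (simp add: acls_eq_iff acong.rel)

text \<open>As rewrite rules these put \<open>U\<close> to the left of \<open>R\<close> and its
  inverse, and all of them to the left of \<open>W\<close> and its inverse, so that the two sides of
  a relation can be compared.\<close>

lemma cat_gen_rels:
  fixes k
  defines "A \<equiv> cat_alg k" and "u \<equiv> cat_gen k cU" and "r \<equiv> cat_gen k cR"
    and "r' \<equiv> cat_gen k cRinv" and "w \<equiv> cat_gen k cW" and "w' \<equiv> cat_gen k cWinv"
  shows "w \<otimes>\<^bsub>A\<^esub> w' = \<one>\<^bsub>A\<^esub>" "w' \<otimes>\<^bsub>A\<^esub> w = \<one>\<^bsub>A\<^esub>" "r \<otimes>\<^bsub>A\<^esub> r' = \<one>\<^bsub>A\<^esub>" "r' \<otimes>\<^bsub>A\<^esub> r = \<one>\<^bsub>A\<^esub>"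
    and "r \<otimes>\<^bsub>A\<^esub> u = u \<otimes>\<^bsub>A\<^esub> r" "r' \<otimes>\<^bsub>A\<^esub> u = u \<otimes>\<^bsub>A\<^esub> r'"
    and "w \<otimes>\<^bsub>A\<^esub> r = of_real (exp k) \<odot>\<^bsub>A\<^esub> (r \<otimes>\<^bsub>A\<^esub> w)"
    and "w \<otimes>\<^bsub>A\<^esub> r' = of_real (exp (- k)) \<odot>\<^bsub>A\<^esub> (r' \<otimes>\<^bsub>A\<^esub> w)"
    and "w' \<otimes>\<^bsub>A\<^esub> r = of_real (exp (- k)) \<odot>\<^bsub>A\<^esub> (r \<otimes>\<^bsub>A\<^esub> w')"
    and "w' \<otimes>\<^bsub>A\<^esub> r' = of_real (exp k) \<odot>\<^bsub>A\<^esub> (r' \<otimes>\<^bsub>A\<^esub> w')"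
    and "w \<otimes>\<^bsub>A\<^esub> u = u \<otimes>\<^bsub>A\<^esub> w \<oplus>\<^bsub>A\<^esub> of_real k \<odot>\<^bsub>A\<^esub> w"
    and "w' \<otimes>\<^bsub>A\<^esub> u = u \<otimes>\<^bsub>A\<^esub> w' \<oplus>\<^bsub>A\<^esub> (- of_real k) \<odot>\<^bsub>A\<^esub> w'"
  unfolding A_def u_def r_def r'_def w_def w'_def cat_alg_def cat_gen_def presented_alg_simps
  by (rule cat_gen_rel, simp only: cat_rels_def insert_iff, simp)+

lemma cat_hom_exists:
  assumes "calgebra B" "\<forall>g. f g \<in> carrier B"
    and "\<forall>(s, t) \<in> cat_rels k. aeval B f s = aeval B f t"
  obtains F where "alg_hom (cat_alg k) B F" "\<And>g. F (cat_gen k g) = f g"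
  using presented_alg_hom_exists[of B f "cat_rels k" UNIV] assms
  unfolding cat_alg_def cat_gen_def by blast

lemma cat_hom_unique:
  assumes "calgebra B" and F: "alg_hom (cat_alg k) B F" and G: "alg_hom (cat_alg k) B G"
    and eq: "F (cat_gen k cU) = G (cat_gen k cU)" "F (cat_gen k cR) = G (cat_gen k cR)"
      "F (cat_gen k cW) = G (cat_gen k cW)"
    and a: "a \<in> carrier (cat_alg k)"
  shows "F a = G a"
proof -
  interpret B: calgebra B by fact
  note inv = alg_hom_inverse_cong[OF B.monoid_axioms F G cat_gen_closed cat_gen_closed]
  have "F (cat_gen k g) = G (cat_gen k g)" for g
    using eq inv[OF cat_gen_rels(3,4) eq(2)] inv[OF cat_gen_rels(1,2) eq(3)] by (cases g) auto
  then show ?thesis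
    using presented_alg_hom_unique[OF F[unfolded cat_alg_def] G[unfolded cat_alg_def] _
        a[unfolded cat_alg_def]] unfolding cat_gen_def by blast
qed

section \<open>Involution of the catenoid algebra\<close>

lemma cat_star_ex1:
  "\<exists>!s. star_involution (cat_alg k) s \<and> s (cat_gen k cU) = cat_gen k cU \<and>
     s (cat_gen k cR) = cat_gen k cR \<and> s (cat_gen k cW) = cat_gen k cWinv"
proof -
  let ?A = "cat_alg k"
  define f where "f g = cat_gen k (case g of cW \<Rightarrow> cWinv | cWinv \<Rightarrow> cW | _ \<Rightarrow> g)" for g
  \<comment> \<open>The scalars are real, so conjugation fixes them. Reversal turns the commutation
    relations of W into those of W^-1 and conversely: WR = e^k RW becomes R W^-1 = e^k W^-1
    R.\<close>
  have "\<forall>(s, t) \<in> cat_rels k. aeval (opc_alg ?A) f s = aeval (opc_alg ?A) f t"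
    unfolding cat_rels_def
    by (auto simp: f_def opc_alg_simps cat_gen_rels cat.smult_simps cat.smult_minus cat.a_assoc
        cat.r_neg cat.l_neg cat.r_minus cat.l_minus simp flip: of_real_mult exp_add)
  then obtain F where F: "alg_hom ?A (opc_alg ?A) F" "\<And>g. F (cat_gen k g) = f g"
    using cat_hom_exists[OF cat.calgebra_opc_alg, of f k k] by (auto simp: opc_alg_simps f_def)
  have "F (F a) = a" if "a \<in> carrier ?A" for a
    by (rule cat_hom_unique[OF calgebra_cat_alg alg_hom_opc_alg_comp[OF F(1) F(1)] alg_hom_id
          _ _ _ that]) (simp_all add: F(2) f_def flip: F(2)[unfolded f_def])
  then have "star_involution ?A (restrict F (carrier ?A))"
    by (rule star_involution_of_hom[OF F(1) _ calgebra_cat_alg])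
  moreover have "s = t" if s: "star_involution ?A s \<and> s (cat_gen k cU) = cat_gen k cU \<and>
     s (cat_gen k cR) = cat_gen k cR \<and> s (cat_gen k cW) = cat_gen k cWinv"
    and t: "star_involution ?A t \<and> t (cat_gen k cU) = cat_gen k cU \<and>
     t (cat_gen k cR) = cat_gen k cR \<and> t (cat_gen k cW) = cat_gen k cWinv" for s t
    using cat_hom_unique[OF cat.calgebra_opc_alg cat.star_involution_hom cat.star_involution_hom,
        of k s t] s t by (intro star_involution_eqI[of ?A s t]) auto
  ultimately show ?thesis
    by (intro ex1I[of _ "restrict F (carrier ?A)"]) (auto simp: F(2) f_def)
qed

lemma
  shows star_involution_cat_star: "star_involution (cat_alg k) (cat_star k)"
    and cat_star_gen [simp]: "cat_star k (cat_gen k cU) = cat_gen k cU"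
      "cat_star k (cat_gen k cR) = cat_gen k cR" "cat_star k (cat_gen k cW) = cat_gen k cWinv"
  using theI'[OF cat_star_ex1[of k]] unfolding cat_star_def[symmetric] by auto

lemmas cat_star_simps = star_involutionD(2-)[OF star_involution_cat_star]

lemma cat_star_Winv [simp]: "cat_star k (cat_gen k cWinv) = cat_gen k cW"
  using cat_star_simps(5)[of "cat_gen k cW" k] by simp

lemma cat_star_Rinv [simp]: "cat_star k (cat_gen k cRinv) = cat_gen k cRinv"
proof -
  have "cat_star k (cat_gen k cRinv) \<otimes>\<^bsub>cat_alg k\<^esub> cat_gen k cR = \<one>\<^bsub>cat_alg k\<^esub>"
    using cat_star_simps(4)[of "cat_gen k cR" k "cat_gen k cRinv"]
    by (simp add: cat_gen_rels cat.star_involution_one[OF star_involution_cat_star])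
  then show ?thesis
    by (rule cat.inv_unique[OF _ cat_gen_rels(3)]) (simp_all add: cat_star_simps)
qed

section \<open>Derivations of the catenoid algebra\<close>

lemma cat_derivation_unique:
  assumes d: "derivation (cat_alg k) d" and e: "derivation (cat_alg k) e"
    and "d (cat_gen k cU) = e (cat_gen k cU)" "d (cat_gen k cR) = e (cat_gen k cR)"
      "d (cat_gen k cW) = e (cat_gen k cW)"
  shows "d = e"
  using cat_hom_unique[OF cat.calgebra_dual_alg cat.derivation_hom[OF d] cat.derivation_hom[OF e]]
    assms by (intro derivation_eqI[OF d e]) auto

text \<open>One family covers both derivations: x = 1, y = 0 for \<open>cat_du\<close> and x = 0, y
  = \<i> for \<open>cat_dv\<close>. Being hermitian forces the conditions on conjugates: U and R are
  self-adjoint, so x is real; the adjoint of W is W^-1, whose derivative is -y W^-1, so y is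
  imaginary.\<close>

lemma cat_derivation_exists:
  fixes x y :: complex
  assumes "cnj x = x" "cnj y = - y"
  obtains d where "hermitian_derivation (cat_alg k) (cat_star k) d"
    "d (cat_gen k cU) = x \<odot>\<^bsub>cat_alg k\<^esub> \<one>\<^bsub>cat_alg k\<^esub>"
    "d (cat_gen k cR) = x \<odot>\<^bsub>cat_alg k\<^esub> cat_gen k cR"
    "d (cat_gen k cW) = y \<odot>\<^bsub>cat_alg k\<^esub> cat_gen k cW"
proof -
  let ?A = "cat_alg k" and ?s = "cat_star k"
  \<comment> \<open>The signs at the two inverses are forced by differentiating R R^-1 = 1 and W
    W^-1 = 1.\<close>
  define \<delta> where "\<delta> g = (case g of cU \<Rightarrow> x \<odot>\<^bsub>?A\<^esub> \<one>\<^bsub>?A\<^esub> | cR \<Rightarrow> x \<odot>\<^bsub>?A\<^esub> cat_gen k g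
    | cRinv \<Rightarrow> (- x) \<odot>\<^bsub>?A\<^esub> cat_gen k g | cW \<Rightarrow> y \<odot>\<^bsub>?A\<^esub> cat_gen k g
    | cWinv \<Rightarrow> (- y) \<odot>\<^bsub>?A\<^esub> cat_gen k g)" for g
  define f where "f g = (cat_gen k g, \<delta> g)" for g
  have \<delta>: "\<delta> g \<in> carrier ?A" for g
    by (simp add: \<delta>_def split: cgen.split)
  \<comment> \<open>All generators except U are scaled by their derivative, with opposite factors
    for an inverse; U is moved by a scalar, which commutes with everything and so drops out of the
    relations with U.\<close>
  have "\<forall>(s, t) \<in> cat_rels k. aeval (dual_alg ?A) f s = aeval (dual_alg ?A) f t"
    unfolding cat_rels_def
    by (auto simp: f_def \<delta>_def dual_alg_simps cat_gen_rels cat.smult_simps cat.smult_add_left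
        cat.a_ac cat.r_neg cat.l_neg cat.minus_eq cat.minus_add cat.l_minus cat.r_minus
        cat.smult_minus cat.smult_minus_right mult.commute)
  then obtain F where F: "alg_hom ?A (dual_alg ?A) F" "\<And>g. F (cat_gen k g) = f g"
    using cat_hom_exists[OF cat.calgebra_dual_alg, of f k k] \<delta> by (auto simp: dual_alg_simps f_def)
  have "fst (F a) = a" if "a \<in> carrier ?A" for a
    by (rule cat_hom_unique[OF calgebra_cat_alg alg_hom_comp[OF F(1) alg_hom_fst_dual_alg]
          alg_hom_id _ _ _ that]) (simp_all add: F(2) f_def)
  then have "derivation ?A (\<lambda>a \<in> carrier ?A. snd (F a))"
    by (rule derivation_of_hom[OF calgebra_cat_alg F(1)])
  moreover define d where "d = (\<lambda>a \<in> carrier ?A. snd (F a))"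
  ultimately have der: "derivation ?A d"
    by simp
  have d: "d (cat_gen k g) = \<delta> g" for g
    by (simp add: d_def F(2) f_def)
  have "(\<lambda>a \<in> carrier ?A. ?s (d (?s a))) = d"
    by (rule cat_derivation_unique[OF derivation_star_conj[OF calgebra_cat_alg der
            star_involution_cat_star] der])
      (simp_all add: d \<delta>_def cat_star_simps assms
        cat.star_involution_one[OF star_involution_cat_star])
  then have "?s (d (?s a)) = d a" if "a \<in> carrier ?A" for a
    using that by (metis restrict_apply')
  then have "d (?s a) = ?s (d a)" if "a \<in> carrier ?A" for a
    using that derivationD(2)[OF der] by (metis cat_star_simps(1,5))
  then show ?thesis
    using der d by (intro that[of d]) (auto simp: hermitian_derivation_def \<delta>_def)
qed

lemma
  shows hermitian_derivation_cat_du: "hermitian_derivation (cat_alg k) (cat_star k) (cat_du k)"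
    and cat_du_gen: "cat_du k (cat_gen k cU) = \<one>\<^bsub>cat_alg k\<^esub>"
      "cat_du k (cat_gen k cR) = cat_gen k cR" "cat_du k (cat_gen k cW) = \<zero>\<^bsub>cat_alg k\<^esub>"
proof -
  let ?P = "\<lambda>d. hermitian_derivation (cat_alg k) (cat_star k) d \<and>
     d (cat_gen k cU) = \<one>\<^bsub>cat_alg k\<^esub> \<and> d (cat_gen k cR) = cat_gen k cR \<and>
     d (cat_gen k cW) = \<zero>\<^bsub>cat_alg k\<^esub>"
  have "\<exists>!d. ?P d"
  proof (rule ex_ex1I)
    show "\<exists>d. ?P d"
      using cat_derivation_exists[of 1 0 k] by (force simp: cat.smult_simps)
  qed (auto intro: cat_derivation_unique simp: hermitian_derivation_def)
  from theI'[OF this] show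
    "hermitian_derivation (cat_alg k) (cat_star k) (cat_du k)"
    "cat_du k (cat_gen k cU) = \<one>\<^bsub>cat_alg k\<^esub>"
    "cat_du k (cat_gen k cR) = cat_gen k cR" "cat_du k (cat_gen k cW) = \<zero>\<^bsub>cat_alg k\<^esub>"
    unfolding cat_du_def[symmetric] by auto
qed

lemma
  shows hermitian_derivation_cat_dv: "hermitian_derivation (cat_alg k) (cat_star k) (cat_dv k)"
    and cat_dv_gen: "cat_dv k (cat_gen k cU) = \<zero>\<^bsub>cat_alg k\<^esub>"
      "cat_dv k (cat_gen k cR) = \<zero>\<^bsub>cat_alg k\<^esub>"
      "cat_dv k (cat_gen k cW) = \<i> \<odot>\<^bsub>cat_alg k\<^esub> cat_gen k cW"
proof -
  let ?P = "\<lambda>d. hermitian_derivation (cat_alg k) (cat_star k) d \<and>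
     d (cat_gen k cU) = \<zero>\<^bsub>cat_alg k\<^esub> \<and> d (cat_gen k cR) = \<zero>\<^bsub>cat_alg k\<^esub> \<and>
     d (cat_gen k cW) = \<i> \<odot>\<^bsub>cat_alg k\<^esub> cat_gen k cW"
  have "\<exists>!d. ?P d"
  proof (rule ex_ex1I)
    show "\<exists>d. ?P d"
      using cat_derivation_exists[of 0 \<i> k] by (force simp: cat.smult_simps)
  qed (auto intro: cat_derivation_unique simp: hermitian_derivation_def)
  from theI'[OF this] show
    "hermitian_derivation (cat_alg k) (cat_star k) (cat_dv k)"
    "cat_dv k (cat_gen k cU) = \<zero>\<^bsub>cat_alg k\<^esub>"
    "cat_dv k (cat_gen k cR) = \<zero>\<^bsub>cat_alg k\<^esub>"
    "cat_dv k (cat_gen k cW) = \<i> \<odot>\<^bsub>cat_alg k\<^esub> cat_gen k cW"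
    unfolding cat_dv_def[symmetric] by auto
qed

section \<open>The symbol of an element of \<open>Z\<close>\<close>

text \<open>
  \<open>\<phi>\<close> is read off from the representation of the algebra on functions in which \<open>U\<close> and \<open>R\<close> act
  by multiplication and \<open>W\<close> acts by translation by $\hbar$: elements of \<open>Z\<close> act by multiplication
  with their symbol, which is the image of the constant function $1$.
\<close>

definition op_alg :: "((real \<Rightarrow> complex) \<Rightarrow> (real \<Rightarrow> complex)) calg" where
  "op_alg =
     \<lparr>carrier = {L. (\<forall>f g. L (\<lambda>x. f x + g x) = (\<lambda>x. L f x + L g x)) \<and>
        (\<forall>c f. L (\<lambda>x. c * f x) = (\<lambda>x. c * L f x))},
      mult = (\<lambda>L M f. L (M f)), one = (\<lambda>f. f), zero = (\<lambda>f x. 0),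
      add = (\<lambda>L M f x. L f x + M f x), smult = (\<lambda>c L f x. c * L f x)\<rparr>"

lemma calgebra_op_alg: "calgebra op_alg"
  by (rule calgebraI) (auto simp: op_alg_def algebra_simps)

definition op_gen :: "real \<Rightarrow> cgen \<Rightarrow> (real \<Rightarrow> complex) \<Rightarrow> real \<Rightarrow> complex" where
  "op_gen k g f x = (case g of cU \<Rightarrow> of_real x * f x | cR \<Rightarrow> of_real (exp x) * f x
    | cRinv \<Rightarrow> of_real (exp (- x)) * f x | cW \<Rightarrow> f (x + k) | cWinv \<Rightarrow> f (x - k))"

lemma op_rep_exists:
  obtains \<rho> where "alg_hom (cat_alg k) op_alg \<rho>" "\<And>g. \<rho> (cat_gen k g) = op_gen k g"
proof (rule cat_hom_exists[OF calgebra_op_alg, of "op_gen k" k])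
  show "\<forall>g. op_gen k g \<in> carrier op_alg"
    by (auto simp: op_alg_def op_gen_def algebra_simps fun_eq_iff split: cgen.split)
  show "\<forall>(s, t) \<in> cat_rels k. aeval op_alg (op_gen k) s = aeval op_alg (op_gen k) t"
    by (auto simp: cat_rels_def op_alg_def op_gen_def fun_eq_iff algebra_simps
        simp flip: of_real_mult exp_add)
qed blast

text \<open>A class of functions that contains the symbols of \<open>Z\<close> and is closed under
  differentiation, so that one derivative at a time yields the whole sequence required by
  \<open>smooth\<close>.\<close>

inductive_set exppoly :: "(real \<Rightarrow> complex) set" where
  "of_real \<in> exppoly"
| "(\<lambda>x. of_real (exp x)) \<in> exppoly"
| "(\<lambda>x. of_real (exp (- x))) \<in> exppoly"
| "(\<lambda>x. c) \<in> exppoly"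
| "f \<in> exppoly \<Longrightarrow> g \<in> exppoly \<Longrightarrow> (\<lambda>x. f x + g x) \<in> exppoly"
| "f \<in> exppoly \<Longrightarrow> g \<in> exppoly \<Longrightarrow> (\<lambda>x. f x * g x) \<in> exppoly"

lemma exppoly_derivative:
  "f \<in> exppoly \<Longrightarrow> \<exists>g \<in> exppoly. \<forall>x. (f has_vector_derivative g x) (at x)"
proof (induction rule: exppoly.induct)
  case 1
  then show ?case
    by (intro bexI[of _ "\<lambda>x. 1"] allI exppoly.intros has_vector_derivative_of_real)
      (auto intro: derivative_eq_intros)
next
  case 2
  then show ?case
    by (intro bexI[of _ "\<lambda>x. of_real (exp x)"] allI exppoly.intros has_vector_derivative_of_real)
      (auto intro!: derivative_eq_intros simp flip: has_real_derivative_iff_has_vector_derivative)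
next
  case 3
  have "((\<lambda>x. of_real (exp (- x)) :: complex) has_vector_derivative of_real (- exp (- x))) (at x)" for x
    by (intro has_vector_derivative_of_real)
      (auto intro!: derivative_eq_intros simp flip: has_real_derivative_iff_has_vector_derivative)
  then show ?case
    using exppoly.intros(6)[OF exppoly.intros(4)[of "- 1"] exppoly.intros(3)]
    by (intro bexI[of _ "\<lambda>x. - 1 * of_real (exp (- x))"]) auto
next
  case (4 c)
  then show ?case
    by (intro bexI[of _ "\<lambda>x. 0"] allI exppoly.intros) auto
next
  case (5 f g)
  then obtain f' g' where "f' \<in> exppoly" "g' \<in> exppoly"
    "\<forall>x. (f has_vector_derivative f' x) (at x)" "\<forall>x. (g has_vector_derivative g' x) (at x)"
    by auto
  then show ?case
    by (intro bexI[of _ "\<lambda>x. f' x + g' x"] allI exppoly.intros has_vector_derivative_add) auto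
next
  case (6 f g)
  then obtain f' g' where "f' \<in> exppoly" "g' \<in> exppoly"
    "\<forall>x. (f has_vector_derivative f' x) (at x)" "\<forall>x. (g has_vector_derivative g' x) (at x)"
    by auto
  with 6 show ?case
    by (intro bexI[of _ "\<lambda>x. f x * g' x + f' x * g x"] allI exppoly.intros
        has_vector_derivative_mult) auto
qed

lemma smooth_exppoly:
  assumes "f \<in> exppoly"
  shows "smooth f"
proof -
  \<comment> \<open>A derivative within the class is chosen for every member; the iterates of this
    choice form the required sequence.\<close>
  obtain D where D: "D g \<in> exppoly" "(g has_vector_derivative D g x) (at x)" if "g \<in> exppoly" for g x
    using exppoly_derivative by metis
  have "(D ^^ n) f \<in> exppoly" for n
    by (induction n) (auto intro: assms D)
  then show ?thesis
    unfolding smooth_def by (intro exI[of _ "\<lambda>n. (D ^^ n) f"]) (auto intro: D)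
qed

abbreviation Z_alg :: "real \<Rightarrow> cgen aterm set calg" where
  "Z_alg k \<equiv> (cat_alg k)\<lparr>carrier := cat_Z k\<rparr>"

lemma cat_Z_closed: "p \<in> cat_Z k \<Longrightarrow> p \<in> carrier (cat_alg k)"
  unfolding cat_Z_def by (induction rule: gen_subalg.induct) auto

lemma cat_phi_exists:
  "\<exists>\<phi>. \<phi> \<in> extensional (cat_Z k) \<and> alg_hom (Z_alg k) smooth_alg \<phi> \<and>
     \<phi> (cat_gen k cU) = (\<lambda>u. of_real u) \<and> \<phi> (cat_gen k cR) = (\<lambda>u. of_real (exp u)) \<and>
     \<phi> (cat_gen k cRinv) = (\<lambda>u. of_real (exp (- u)))"
proof -
  obtain \<rho> where \<rho>: "alg_hom (cat_alg k) op_alg \<rho>" "\<And>g. \<rho> (cat_gen k g) = op_gen k g"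
    using op_rep_exists[of k] by blast
  note hom = alg_homD(2-)[OF \<rho>(1)]
  have "\<exists>f \<in> exppoly. \<rho> p = (\<lambda>g x. f x * g x)" if "p \<in> cat_Z k" for p
    using that unfolding cat_Z_def
  proof (induction rule: gen_subalg.induct)
    case (gen p)
    then show ?case
      by (auto simp: \<rho>(2) op_gen_def fun_eq_iff intro: exppoly.intros)
  next
    case one
    show ?case
      by (intro bexI[of _ "\<lambda>x. 1"] exppoly.intros) (simp add: hom op_alg_def)
  next
    case (add a b)
    then obtain f g where fg: "f \<in> exppoly" "g \<in> exppoly" and
      "\<rho> a = (\<lambda>h x. f x * h x)" "\<rho> b = (\<lambda>h x. g x * h x)"
      by auto
    moreover have "a \<in> carrier (cat_alg k)" "b \<in> carrier (cat_alg k)"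
      using add(1,2) by (simp_all add: cat_Z_closed[unfolded cat_Z_def])
    ultimately show ?case
      by (intro bexI[OF _ exppoly.intros(5)[OF fg]]) (simp add: hom op_alg_def algebra_simps)
  next
    case (mult a b)
    then obtain f g where fg: "f \<in> exppoly" "g \<in> exppoly" and
      "\<rho> a = (\<lambda>h x. f x * h x)" "\<rho> b = (\<lambda>h x. g x * h x)"
      by auto
    moreover have "a \<in> carrier (cat_alg k)" "b \<in> carrier (cat_alg k)"
      using mult(1,2) by (simp_all add: cat_Z_closed[unfolded cat_Z_def])
    ultimately show ?case
      by (intro bexI[OF _ exppoly.intros(6)[OF fg]]) (simp add: hom op_alg_def algebra_simps)
  next
    case (smult a c)
    then obtain f where f: "f \<in> exppoly" and "\<rho> a = (\<lambda>h x. f x * h x)"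
      by auto
    moreover have "a \<in> carrier (cat_alg k)"
      using smult(1) by (simp add: cat_Z_closed[unfolded cat_Z_def])
    ultimately show ?case
      by (intro bexI[OF _ exppoly.intros(6)[OF exppoly.intros(4)[of c] f]])
        (simp add: hom op_alg_def algebra_simps)
  qed
  then obtain \<psi> where \<psi>: "\<psi> p \<in> exppoly" "\<rho> p = (\<lambda>g x. \<psi> p x * g x)" if "p \<in> cat_Z k" for p
    by metis
  \<comment> \<open>The symbol was obtained by choice; evaluation at the constant function 1 pins it
    down, so its homomorphism laws reduce to those of the representation.\<close>
  have \<psi>_eq: "\<psi> p = \<rho> p (\<lambda>x. 1)" if "p \<in> cat_Z k" for p
    by (simp add: \<psi>(2)[OF that])
  have Z: "a \<oplus>\<^bsub>cat_alg k\<^esub> b \<in> cat_Z k" "a \<otimes>\<^bsub>cat_alg k\<^esub> b \<in> cat_Z k" "c \<odot>\<^bsub>cat_alg k\<^esub> a \<in> cat_Z k"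
    "\<one>\<^bsub>cat_alg k\<^esub> \<in> cat_Z k"
    if "a \<in> cat_Z k" "b \<in> cat_Z k" for a b c
    using that unfolding cat_Z_def by (auto intro: gen_subalg.intros)
  have gen: "cat_gen k cU \<in> cat_Z k" "cat_gen k cR \<in> cat_Z k" "cat_gen k cRinv \<in> cat_Z k"
    unfolding cat_Z_def by (auto intro: gen_subalg.gen)
  have "alg_hom (Z_alg k) smooth_alg (restrict \<psi> (cat_Z k))"
  proof (rule alg_homI)
    fix a b assume ab: "a \<in> carrier (Z_alg k)" "b \<in> carrier (Z_alg k)"
    then have ab: "a \<in> cat_Z k" "b \<in> cat_Z k"
      by simp_all
    note cl = ab[THEN cat_Z_closed]
    show "restrict \<psi> (cat_Z k) (a \<oplus>\<^bsub>Z_alg k\<^esub> b) =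
        restrict \<psi> (cat_Z k) a \<oplus>\<^bsub>smooth_alg\<^esub> restrict \<psi> (cat_Z k) b"
      using ab Z[OF ab] cl by (simp add: \<psi>_eq hom) (simp add: op_alg_def smooth_alg_def)
    show "restrict \<psi> (cat_Z k) (a \<otimes>\<^bsub>Z_alg k\<^esub> b) =
        restrict \<psi> (cat_Z k) a \<otimes>\<^bsub>smooth_alg\<^esub> restrict \<psi> (cat_Z k) b"
      \<comment> \<open>Only the right factor is evaluated at the constant function; the left one is
        then applied, as a multiplication operator, to the symbol of the right one.\<close>
      using ab Z[OF ab] cl \<psi>(2)[OF ab(1)] \<psi>_eq[of "a \<otimes>\<^bsub>cat_alg k\<^esub> b"] \<psi>_eq[OF ab(2)]
      by (simp add: hom) (simp add: op_alg_def smooth_alg_def)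
  next
    fix a c assume "a \<in> carrier (Z_alg k)"
    then have a: "a \<in> cat_Z k" by simp
    then show "restrict \<psi> (cat_Z k) a \<in> carrier smooth_alg"
      by (simp add: smooth_alg_def smooth_exppoly \<psi>(1))
    show "restrict \<psi> (cat_Z k) (c \<odot>\<^bsub>Z_alg k\<^esub> a) = c \<odot>\<^bsub>smooth_alg\<^esub> restrict \<psi> (cat_Z k) a"
      using a Z[OF a a] cat_Z_closed[OF a]
      by (simp add: \<psi>_eq hom) (simp add: op_alg_def smooth_alg_def)
  next
    show "restrict \<psi> (cat_Z k) \<one>\<^bsub>Z_alg k\<^esub> = \<one>\<^bsub>smooth_alg\<^esub>"
      using Z(4)[OF gen(1,1)] by (simp add: \<psi>_eq hom) (simp add: op_alg_def smooth_alg_def)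
  qed
  then show ?thesis
    using gen by (intro exI[of _ "restrict \<psi> (cat_Z k)"]) (auto simp: \<psi>_eq \<rho>(2) op_gen_def)
qed

lemma cat_phi_unique:
  assumes \<phi>: "alg_hom (Z_alg k) smooth_alg \<phi>" and \<psi>: "alg_hom (Z_alg k) smooth_alg \<psi>"
    and "\<phi> (cat_gen k cU) = \<psi> (cat_gen k cU)" "\<phi> (cat_gen k cR) = \<psi> (cat_gen k cR)"
      "\<phi> (cat_gen k cRinv) = \<psi> (cat_gen k cRinv)"
    and "p \<in> cat_Z k"
  shows "\<phi> p = \<psi> p"
proof -
  note hom = alg_homD(2-)[OF \<phi>, simplified, unfolded cat_Z_def]
    alg_homD(2-)[OF \<psi>, simplified, unfolded cat_Z_def]
  show ?thesis
    using assms(6) unfolding cat_Z_def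
    by (induction rule: gen_subalg.induct) (use assms(3-5) in \<open>auto simp: hom\<close>)
qed

lemma
  shows alg_hom_cat_phi: "alg_hom (Z_alg k) smooth_alg (cat_phi k)"
    and cat_phi_gen: "cat_phi k (cat_gen k cU) = (\<lambda>u. of_real u)"
      "cat_phi k (cat_gen k cR) = (\<lambda>u. of_real (exp u))"
      "cat_phi k (cat_gen k cRinv) = (\<lambda>u. of_real (exp (- u)))"
proof -
  let ?P = "\<lambda>\<phi>. \<phi> \<in> extensional (cat_Z k) \<and> alg_hom (Z_alg k) smooth_alg \<phi> \<and>
     \<phi> (cat_gen k cU) = (\<lambda>u. of_real u) \<and> \<phi> (cat_gen k cR) = (\<lambda>u. of_real (exp u)) \<and>
     \<phi> (cat_gen k cRinv) = (\<lambda>u. of_real (exp (- u)))"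
  have "\<exists>!\<phi>. ?P \<phi>"
  proof (rule ex_ex1I[OF cat_phi_exists])
    fix \<phi> \<psi> assume "?P \<phi>" "?P \<psi>"
    then show "\<phi> = \<psi>"
      using cat_phi_unique[of k \<phi> \<psi>] by (intro extensionalityI[of \<phi> "cat_Z k" \<psi>]) auto
  qed
  from theI'[OF this] show
    "alg_hom (Z_alg k) smooth_alg (cat_phi k)"
    "cat_phi k (cat_gen k cU) = (\<lambda>u. of_real u)"
    "cat_phi k (cat_gen k cR) = (\<lambda>u. of_real (exp u))"
    "cat_phi k (cat_gen k cRinv) = (\<lambda>u. of_real (exp (- u)))"
    unfolding cat_phi_def[symmetric] by auto
qed

text \<open>The symbols of the generators are real-valued, and the reversal of products is harmless
  because symbols commute. Since conjugation preserves the modulus, the inverted set is stable under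
  the involution.\<close>

lemma cat_phi_star:
  assumes "p \<in> cat_Z k"
  shows "cat_star k p \<in> cat_Z k \<and> cat_phi k (cat_star k p) = (\<lambda>u. cnj (cat_phi k p u))"
proof -
  note hom = alg_homD(2-)[OF alg_hom_cat_phi[of k], simplified, unfolded cat_Z_def]
  note cl = cat_Z_closed[of _ k, unfolded cat_Z_def]
  note star = cat_star_simps cat.star_involution_one[OF star_involution_cat_star]
  show ?thesis
    using assms unfolding cat_Z_def
  proof (induction rule: gen_subalg.induct)
    case (gen x)
    then show ?case
      by (auto simp: cat_phi_gen intro: gen_subalg.gen)
  qed (use cl in \<open>auto simp: hom star smooth_alg_def intro: gen_subalg.intros\<close>)
qed

lemma cat_star_Zplus: "cat_star k ` cat_Zplus k \<subseteq> cat_Zplus k"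
  using cat_phi_star unfolding cat_Zplus_def by fastforce

lemma cat_Zplus_subset: "cat_Zplus k \<subseteq> carrier (cat_alg k)"
  using cat_Z_closed unfolding cat_Zplus_def by blast

section \<open>Involution and derivations of the localized algebra\<close>

lemma calgebra_hat_alg: "calgebra (hat_alg k)"
  unfolding hat_alg_def by (rule calgebra_localization)

interpretation hat: calgebra "hat_alg k" for k
  by (rule calgebra_hat_alg)

lemma alg_hom_hat_emb: "alg_hom (cat_alg k) (hat_alg k) (hat_emb k)"
  unfolding hat_alg_def hat_emb_def by (rule loc_map_hom)

lemma
  shows star_involution_hat_star: "star_involution (hat_alg k) (hat_star k)"
    and hat_star_emb: "\<And>a. a \<in> carrier (cat_alg k) \<Longrightarrow>
      hat_star k (hat_emb k a) = hat_emb k (cat_star k a)"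
  using theI'[OF ex1_star_localization[OF calgebra_cat_alg cat_Zplus_subset
        star_involution_cat_star cat_star_Zplus, of k]]
  unfolding hat_star_def hat_alg_def hat_emb_def by auto

lemma hat_derivation_ex1:
  "hermitian_derivation (cat_alg k) (cat_star k) d \<Longrightarrow>
    \<exists>!D. derivation (hat_alg k) D \<and> (\<forall>a \<in> carrier (cat_alg k). D (hat_emb k a) = hat_emb k (d a))"
  unfolding hat_alg_def hat_emb_def hermitian_derivation_def
  by (intro ex1_derivation_localization[OF calgebra_cat_alg cat_Zplus_subset]) simp

text \<open>Conjugating \<open>D\<close> by the involution gives a derivation that extends the same
  \<open>d\<close>, because \<open>d\<close> is hermitian; the extension being unique, it is
  \<open>D\<close> itself.\<close>

lemma hat_derivation_hermitian:
  assumes "hermitian_derivation (cat_alg k) (cat_star k) d" "derivation (hat_alg k) D"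
    and "\<forall>a \<in> carrier (cat_alg k). D (hat_emb k a) = hat_emb k (d a)"
    and a: "a \<in> carrier (hat_alg k)"
  shows "hat_star k (D a) = D (hat_star k a)"
proof -
  note star = star_involutionD[OF star_involution_hat_star]
  have d: "d (cat_star k a) = cat_star k (d a)" "d a \<in> carrier (cat_alg k)"
    if "a \<in> carrier (cat_alg k)" for a
    using assms(1) that derivationD(2) unfolding hermitian_derivation_def by auto
  have emb: "hat_emb k a \<in> carrier (hat_alg k)" if "a \<in> carrier (cat_alg k)" for a
    using alg_homD(1)[OF alg_hom_hat_emb that] .
  have "(\<lambda>a \<in> carrier (hat_alg k). hat_star k (D (hat_star k a))) = D" (is "?D = D")
  proof -
    have "derivation (hat_alg k) ?D"
      by (rule derivation_star_conj[OF calgebra_hat_alg assms(2) star_involution_hat_star])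
    moreover have "\<forall>a \<in> carrier (cat_alg k). ?D (hat_emb k a) = hat_emb k (d a)"
      using assms(3) by (simp add: emb hat_star_emb d cat_star_simps)
    ultimately show ?thesis
      using hat_derivation_ex1[OF assms(1)] assms(2,3) by (metis (no_types, lifting))
  qed
  then have "hat_star k (D (hat_star k b)) = D b" if "b \<in> carrier (hat_alg k)" for b
    using that by (metis restrict_apply')
  from this[of "hat_star k a"] show ?thesis
    using a by (simp add: star)
qed

lemma
  shows derivation_hat_du: "derivation (hat_alg k) (hat_du k)"
    and hat_du_emb: "\<forall>a \<in> carrier (cat_alg k). hat_du k (hat_emb k a) = hat_emb k (cat_du k a)"
  using theI'[OF hat_derivation_ex1[OF hermitian_derivation_cat_du, of k]]
  unfolding hat_du_def by auto

lemma
  shows derivation_hat_dv: "derivation (hat_alg k) (hat_dv k)"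
    and hat_dv_emb: "\<forall>a \<in> carrier (cat_alg k). hat_dv k (hat_emb k a) = hat_emb k (cat_dv k a)"
  using theI'[OF hat_derivation_ex1[OF hermitian_derivation_cat_dv, of k]]
  unfolding hat_dv_def by auto

lemmas hat_star_du =
  hat_derivation_hermitian[OF hermitian_derivation_cat_du derivation_hat_du hat_du_emb]
lemmas hat_star_dv =
  hat_derivation_hermitian[OF hermitian_derivation_cat_dv derivation_hat_dv hat_dv_emb]

section \<open>Vector fields and connections\<close>

lemma derivation_lincomb:
  assumes "derivation (hat_alg k) d" "derivation (hat_alg k) e"
  shows "derivation (hat_alg k) (lincomb k c d c' e)"
  unfolding derivation_def lincomb_def
  by (auto simp: derivationD(2-)[OF assms(1)] derivationD(2-)[OF assms(2)] hat.smult_simps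
      hat.l_distr hat.r_distr hat.a_ac mult.commute)

lemma lincomb_lincomb:
  assumes "derivation (hat_alg k) d" "derivation (hat_alg k) e"
  shows "lincomb k c (lincomb k a d b e) c' (lincomb k a' d b' e) =
    lincomb k (c * a + c' * a') d (c * b + c' * b') e"
  unfolding lincomb_def
  by (rule restrict_ext) (simp add: derivationD(2)[OF assms(1)] derivationD(2)[OF assms(2)]
      hat.smult_simps hat.smult_add_left hat.a_ac)

section \<open>Coordinates of vector fields\<close>

locale catenoid_form =
  fixes k :: real and A :: "hat calg" (structure) and S T :: hat
    and h :: "vec3 \<Rightarrow> vec3 \<Rightarrow> hat"
  assumes A_def: "A = hat_alg k"
    and S_unit: "S \<in> Units A" and T_unit: "T \<in> Units A"
    and form: "hermitian_form k h"
    and h_Phi: "h (Phi k) (Phi k) = S" and h_Phibar: "h (Phibar k) (Phibar k) = T"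
    and h_Phi_Phibar: "h (Phi k) (Phibar k) = \<zero>"

sublocale catenoid_form \<subseteq> calgebra A
  unfolding A_def by (rule calgebra_hat_alg)

context catenoid_form
begin

abbreviation s where "s \<equiv> hat_star k"

lemmas star = star_involutionD(2-)[OF star_involution_hat_star[of k, folded A_def]]
lemmas star_one = star_involution_one[OF star_involution_hat_star[of k, folded A_def]]

lemma star_zero: "s \<zero> = \<zero>"
  using star(3)[of \<zero> 0] star(1)[of \<zero>] by (simp add: smult_0_left)

lemma S_closed [simp]: "S \<in> carrier A" and T_closed [simp]: "T \<in> carrier A"
  using S_unit T_unit by auto

definition V :: "hat \<Rightarrow> hat \<Rightarrow> vec3" where
  "V a b = vadd k (vact k (Phi k) a) (vact k (Phibar k) b)"

lemma vfields_eq: "vfields k = {V a b | a b. a \<in> carrier A \<and> b \<in> carrier A}"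
  unfolding vfields_def V_def A_def ..

lemma V_in_vfields [simp, intro]: "a \<in> carrier A \<Longrightarrow> b \<in> carrier A \<Longrightarrow> V a b \<in> vfields k"
  unfolding vfields_eq by auto

declare vadd.simps [simp del] vact.simps [simp del] vsmult.simps [simp del]

lemma vec_ops:
  "vadd k (x1, x2, x3) (y1, y2, y3) = (x1 \<oplus> y1, x2 \<oplus> y2, x3 \<oplus> y3)"
  "vact k (x1, x2, x3) a = (x1 \<otimes> a, x2 \<otimes> a, x3 \<otimes> a)"
  "vsmult k c (x1, x2, x3) = (c \<odot> x1, c \<odot> x2, c \<odot> x3)"
  "vzero k = (\<zero>, \<zero>, \<zero>)"
  by (simp_all add: A_def vzero_def vadd.simps vact.simps vsmult.simps)

lemma Phi_components:
  obtains p1 p2 p3 q1 q2 q3 where "Phi k = (p1, p2, p3)" "Phibar k = (q1, q2, q3)"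
    and "p1 \<in> carrier A" "p2 \<in> carrier A" "p3 \<in> carrier A"
      "q1 \<in> carrier A" "q2 \<in> carrier A" "q3 \<in> carrier A"
proof -
  have "hat_emb k (cat_gen k g) \<in> carrier A" for g
    unfolding A_def by (intro alg_homD(1)[OF alg_hom_hat_emb] cat_gen_closed)
  then have "Phi k \<in> carrier A \<times> carrier A \<times> carrier A"
    by (auto simp: Phi_def Let_def simp flip: A_def)
  then show ?thesis
    using that star(1) by (cases "Phi k") (auto simp: Phibar_def)
qed

lemma V_ops:
  assumes "a \<in> carrier A" "b \<in> carrier A"
  shows "\<And>c. c \<in> carrier A \<Longrightarrow> vact k (V a b) c = V (a \<otimes> c) (b \<otimes> c)"
    and "\<And>z. vsmult k z (V a b) = V (z \<odot> a) (z \<odot> b)"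
    and "\<And>c d. c \<in> carrier A \<Longrightarrow> d \<in> carrier A \<Longrightarrow>
      vadd k (V a b) (V c d) = V (a \<oplus> c) (b \<oplus> d)"
proof -
  obtain p1 p2 p3 q1 q2 q3 where *: "Phi k = (p1, p2, p3)" "Phibar k = (q1, q2, q3)"
    "p1 \<in> carrier A" "p2 \<in> carrier A" "p3 \<in> carrier A"
    "q1 \<in> carrier A" "q2 \<in> carrier A" "q3 \<in> carrier A"
    by (rule Phi_components)
  show "vact k (V a b) c = V (a \<otimes> c) (b \<otimes> c)" if "c \<in> carrier A" for c
    using * assms that by (simp add: V_def vec_ops l_distr m_assoc)
  show "vsmult k z (V a b) = V (z \<odot> a) (z \<odot> b)" for z
    using * assms by (simp add: V_def vec_ops smult_simps)
  show "vadd k (V a b) (V c d) = V (a \<oplus> c) (b \<oplus> d)" if "c \<in> carrier A" "d \<in> carrier A" for c d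
    using * assms that by (simp add: V_def vec_ops r_distr a_ac)
qed

lemma Phi_eq: "Phi k = V \<one> \<zero>" and Phibar_eq: "Phibar k = V \<zero> \<one>" and vzero_eq: "vzero k = V \<zero> \<zero>"
proof -
  obtain p1 p2 p3 q1 q2 q3 where "Phi k = (p1, p2, p3)" "Phibar k = (q1, q2, q3)"
    "p1 \<in> carrier A" "p2 \<in> carrier A" "p3 \<in> carrier A"
    "q1 \<in> carrier A" "q2 \<in> carrier A" "q3 \<in> carrier A"
    by (rule Phi_components)
  then show "Phi k = V \<one> \<zero>" "Phibar k = V \<zero> \<one>" "vzero k = V \<zero> \<zero>"
    by (simp_all add: V_def vec_ops)
qed

lemma Phi_act: "a \<in> carrier A \<Longrightarrow> vact k (Phi k) a = V a \<zero>"
  and Phibar_act: "a \<in> carrier A \<Longrightarrow> vact k (Phibar k) a = V \<zero> a"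
  by (simp_all add: Phi_eq Phibar_eq V_ops)

section \<open>The hermitian form in coordinates\<close>

lemma
  shows h_add: "\<And>X Y Z. X \<in> vfields k \<Longrightarrow> Y \<in> vfields k \<Longrightarrow> Z \<in> vfields k \<Longrightarrow>
      h X (vadd k Y Z) = h X Y \<oplus> h X Z"
    and h_star: "\<And>X Y. X \<in> vfields k \<Longrightarrow> Y \<in> vfields k \<Longrightarrow> s (h X Y) = h Y X"
    and h_act: "\<And>X Y a. X \<in> vfields k \<Longrightarrow> Y \<in> vfields k \<Longrightarrow> a \<in> carrier A \<Longrightarrow>
      h X (vact k Y a) = h X Y \<otimes> a"
  using form unfolding hermitian_form_def A_def by auto

lemma Phi_vfields [simp]: "Phi k \<in> vfields k" "Phibar k \<in> vfields k"
  by (auto simp: Phi_eq Phibar_eq)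

lemma star_S: "s S = S" and star_T: "s T = T" and h_Phibar_Phi: "h (Phibar k) (Phi k) = \<zero>"
proof -
  show "s S = S" "s T = T"
    using h_star[of "Phi k" "Phi k"] h_star[of "Phibar k" "Phibar k"] h_Phi h_Phibar by simp_all
  show "h (Phibar k) (Phi k) = \<zero>"
    using h_star[of "Phi k" "Phibar k"] h_Phi_Phibar by (simp add: star_zero)
qed

lemma h_V_right:
  assumes "X \<in> vfields k" "a \<in> carrier A" "b \<in> carrier A"
  shows "h X (V a b) = h X (Phi k) \<otimes> a \<oplus> h X (Phibar k) \<otimes> b"
proof -
  have "V a b = vadd k (vact k (Phi k) a) (vact k (Phibar k) b)"
    by (rule V_def)
  moreover have "vact k (Phi k) a \<in> vfields k" "vact k (Phibar k) b \<in> vfields k"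
    using assms by (auto simp: Phi_act Phibar_act)
  ultimately show ?thesis
    using assms by (simp add: h_add h_act)
qed

text \<open>Right linearity is an axiom only in the second argument; hermitian symmetry carries it
  to the first, where coefficients come out on the left and starred.\<close>

lemma h_V:
  assumes "a \<in> carrier A" "b \<in> carrier A" "a' \<in> carrier A" "b' \<in> carrier A"
  shows "h (V a b) (V a' b') = s a \<otimes> S \<otimes> a' \<oplus> s b \<otimes> T \<otimes> b'"
proof -
  have "h (V a b) (Phi k) = s a \<otimes> S" "h (V a b) (Phibar k) = s b \<otimes> T"
    using assms h_star[of "Phi k" "V a b"] h_star[of "Phibar k" "V a b"]
    by (simp_all add: h_V_right h_Phi h_Phibar h_Phi_Phibar h_Phibar_Phi star star_S star_T)
  then show ?thesis
    using assms by (simp add: h_V_right)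
qed

text \<open>Nondegeneracy of the form makes the generators \<open>\<Phi>\<close> and $\bar\Phi$ a basis.\<close>

lemma V_eq_iff:
  assumes "a \<in> carrier A" "b \<in> carrier A" "a' \<in> carrier A" "b' \<in> carrier A"
  shows "V a b = V a' b' \<longleftrightarrow> a = a' \<and> b = b'"
proof
  assume eq: "V a b = V a' b'"
  have "S \<otimes> a = S \<otimes> a'" "T \<otimes> b = T \<otimes> b'"
    using assms arg_cong[OF eq, of "h (Phi k)"] arg_cong[OF eq, of "h (Phibar k)"]
    by (simp_all add: h_V_right h_Phi h_Phibar h_Phi_Phibar h_Phibar_Phi)
  then show "a = a' \<and> b = b'"
    using assms S_unit T_unit by (simp add: Units_l_cancel)
qed simp

section \<open>The almost complex structure\<close>

lemma Jmap_V:
  assumes "a \<in> carrier A" "b \<in> carrier A"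
  shows "Jmap k (V a b) = V (\<i> \<odot> a) ((- \<i>) \<odot> b)"
proof -
  let ?P = "\<lambda>f. module_hom k f \<and> f (Phi k) = vsmult k \<i> (Phi k) \<and>
    f (Phibar k) = vsmult k (- \<i>) (Phibar k)"
  have val: "f (V a b) = V (\<i> \<odot> a) ((- \<i>) \<odot> b)"
    if f: "?P f" and ab: "a \<in> carrier A" "b \<in> carrier A" for f a b
  proof -
    have *: "f (vadd k X Y) = vadd k (f X) (f Y)" "f (vact k X c) = vact k (f X) c"
      if "X \<in> vfields k" "Y \<in> vfields k" "c \<in> carrier A" for X Y c
      using f that unfolding module_hom_def A_def by auto
    have "f (V a b) = vadd k (f (vact k (Phi k) a)) (f (vact k (Phibar k) b))"
      unfolding V_def using *(1)[of "vact k (Phi k) a" "vact k (Phibar k) b" \<zero>] ab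
      by (simp add: Phi_act Phibar_act)
    also have "\<dots> = vadd k (vact k (vsmult k \<i> (Phi k)) a) (vact k (vsmult k (- \<i>) (Phibar k)) b)"
      using f ab *(2)[OF _ _ ab(1), of "Phi k" "Phi k"] *(2)[OF _ _ ab(2), of "Phibar k" "Phi k"]
      by simp
    also have "\<dots> = V (\<i> \<odot> a) ((- \<i>) \<odot> b)"
      using ab by (simp add: Phi_eq Phibar_eq V_ops smult_simps)
    finally show ?thesis .
  qed
  \<comment> \<open>Uniqueness of coordinates leaves exactly one candidate for the choice, so this
    witness has the expected values.\<close>
  define g where "g = (\<lambda>X \<in> vfields k. SOME Y. \<exists>a \<in> carrier A. \<exists>b \<in> carrier A. X = V a b \<and>
    Y = V (\<i> \<odot> a) ((- \<i>) \<odot> b))"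
  have g: "g (V a b) = V (\<i> \<odot> a) ((- \<i>) \<odot> b)" if "a \<in> carrier A" "b \<in> carrier A" for a b
    unfolding g_def using that by (auto simp: V_eq_iff intro!: some_equality)
  have "?P g"
  proof (intro conjI)
    show "module_hom k g"
      unfolding module_hom_def A_def[symmetric]
    proof (intro conjI ballI)
      show "g \<in> vfields k \<rightarrow>\<^sub>E vfields k"
      proof (rule PiE_I)
        show "g X \<in> vfields k" if "X \<in> vfields k" for X
          using that g unfolding vfields_eq by auto
      qed (simp add: g_def)
    qed (auto simp: vfields_eq g V_ops smult_simps)
  qed (simp_all add: Phi_eq Phibar_eq g V_ops smult_simps)
  moreover have "f = g" if "?P f" for f
  proof (rule PiE_ext)
    show "f \<in> vfields k \<rightarrow>\<^sub>E vfields k" "g \<in> vfields k \<rightarrow>\<^sub>E vfields k"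
      using that \<open>?P g\<close> unfolding module_hom_def by blast+
    show "f X = g X" if "X \<in> vfields k" for X
      using that val[OF \<open>?P f\<close>] g by (auto simp: vfields_eq)
  qed
  ultimately have "Jmap k = g"
    unfolding Jmap_def by (rule the_equality)
  then show ?thesis
    using g assms by simp
qed

section \<open>The Lie algebra in the basis \<open>hat_d\<close>, \<open>hat_dbar\<close>\<close>

abbreviation L :: "complex \<Rightarrow> complex \<Rightarrow> hat \<Rightarrow> hat" where
  "L \<alpha> \<beta> \<equiv> lincomb k \<alpha> (hat_d k) \<beta> (hat_dbar k)"

lemma derivation_hat_d: "derivation A (hat_d k)" and derivation_hat_dbar: "derivation A (hat_dbar k)"
  unfolding A_def hat_d_def hat_dbar_def
  by (intro derivation_lincomb derivation_hat_du derivation_hat_dv)+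

lemmas hat_d = derivationD(2-)[OF derivation_hat_d]
lemmas hat_dbar = derivationD(2-)[OF derivation_hat_dbar]

lemma derivation_L: "derivation A (L \<alpha> \<beta>)"
  using derivation_hat_d derivation_hat_dbar unfolding A_def by (rule derivation_lincomb)

lemmas L = derivationD(2-)[OF derivation_L]

lemma L_apply: "a \<in> carrier A \<Longrightarrow> L \<alpha> \<beta> a = \<alpha> \<odot> hat_d k a \<oplus> \<beta> \<odot> hat_dbar k a"
  by (simp add: lincomb_def A_def)

lemma L_du_dv: "L \<alpha> \<beta> = lincomb k ((\<alpha> + \<beta>) / 2) (hat_du k) (\<i> * (\<beta> - \<alpha>) / 2) (hat_dv k)"
  unfolding hat_d_def hat_dbar_def lincomb_lincomb[OF derivation_hat_du derivation_hat_dv]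
  by (rule arg_cong2[where f = "\<lambda>x y. lincomb k x _ y _"]) (simp_all add: field_simps)

lemma lie_g_eq: "lie_g k = {L \<alpha> \<beta> | \<alpha> \<beta>. True}"
proof -
  \<comment> \<open>Inverting the change of basis: \<partial>_u is the sum of \<open>hat_d\<close>
    and \<open>hat_dbar\<close>, and \<partial>_v is \<i> times their difference.\<close>
  have "lincomb k c (hat_du k) c' (hat_dv k) = L (c + \<i> * c') (c - \<i> * c')" for c c'
    unfolding L_du_dv
    by (rule arg_cong2[where f = "\<lambda>x y. lincomb k x _ y _"]) (simp_all add: field_simps)
  then show ?thesis
    unfolding lie_g_def L_du_dv by fastforce
qed

lemma L_in_lie_g [simp]: "L \<alpha> \<beta> \<in> lie_g k"
  unfolding lie_g_eq by auto

lemma hat_d_eq: "hat_d k = L 1 0" and hat_dbar_eq: "hat_dbar k = L 0 1"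
  by (rule derivation_eqI[OF derivation_hat_d derivation_L]
      derivation_eqI[OF derivation_hat_dbar derivation_L],
      simp add: L_apply hat_d hat_dbar smult_simps)+

lemma lincomb_L: "lincomb k c (L \<alpha> \<beta>) c' (L \<alpha>' \<beta>') = L (c * \<alpha> + c' * \<alpha>') (c * \<beta> + c' * \<beta>')"
  using derivation_hat_d derivation_hat_dbar unfolding A_def by (rule lincomb_lincomb)

text \<open>
  If the localized algebra were trivial, \<open>L \<alpha> \<beta>\<close> would not determine \<open>\<alpha>\<close> and \<open>\<beta>\<close>, but only their
  action on the algebra matters. It is recovered from the values at the generators \<open>U\<close> and \<open>W\<close>.
\<close>

lemma L_coeffs:
  assumes eq: "L \<alpha> \<beta> = L \<alpha>' \<beta>'" and x: "x \<in> carrier A"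
  shows "\<alpha> \<odot> x = \<alpha>' \<odot> x" "\<beta> \<odot> x = \<beta>' \<odot> x"
proof -
  note emb = alg_homD[OF alg_hom_hat_emb[of k, folded A_def]]
  define u w w' where "u = hat_emb k (cat_gen k cU)" and "w = hat_emb k (cat_gen k cW)"
    and "w' = hat_emb k (cat_gen k cWinv)"
  have closed: "u \<in> carrier A" "w \<in> carrier A" "w' \<in> carrier A"
    by (simp_all add: u_def w_def w'_def emb)
  have zero: "hat_emb k \<zero>\<^bsub>cat_alg k\<^esub> = \<zero>"
    using alg_hom_zero[OF calgebra_cat_alg calgebra_hat_alg alg_hom_hat_emb] by (simp add: A_def)
  have ww': "w \<otimes> w' = \<one>"
    by (simp add: w_def w'_def emb cat_gen_rels flip: emb(3))
  have du: "hat_du k u = \<one>" "hat_du k w = \<zero>"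
    using hat_du_emb by (simp_all add: u_def w_def cat_du_gen emb zero)
  have dv: "hat_dv k u = \<zero>" "hat_dv k w = \<i> \<odot> w"
    using hat_dv_emb by (simp_all add: u_def w_def cat_dv_gen emb zero)
  have U: "L \<alpha> \<beta> u = ((\<alpha> + \<beta>) / 2) \<odot> \<one>" and W: "L \<alpha> \<beta> w = ((\<alpha> - \<beta>) / 2) \<odot> w" for \<alpha> \<beta>
    unfolding L_du_dv unfolding lincomb_def using closed
    by (simp_all add: du dv smult_simps flip: A_def) (simp add: field_simps)
  have 1: "((\<alpha> + \<beta>) / 2) \<odot> \<one> = ((\<alpha>' + \<beta>') / 2) \<odot> \<one>"
    using arg_cong[OF eq, of "\<lambda>d. d u"] by (simp add: U)
  \<comment> \<open>Both derivations scale W, and W is invertible, so W can be stripped to leave the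
    factors acting on the unit.\<close>
  have "((\<alpha> - \<beta>) / 2) \<odot> (w \<otimes> w') = ((\<alpha>' - \<beta>') / 2) \<odot> (w \<otimes> w')"
    using arg_cong[OF eq, of "\<lambda>d. d w \<otimes> w'"] closed by (simp add: W mult_smult_left)
  then have 2: "((\<alpha> - \<beta>) / 2) \<odot> \<one> = ((\<alpha>' - \<beta>') / 2) \<odot> \<one>"
    by (simp add: ww')
  have "\<alpha> \<odot> \<one> = ((\<alpha> + \<beta>) / 2) \<odot> \<one> \<oplus> ((\<alpha> - \<beta>) / 2) \<odot> \<one>" for \<alpha> \<beta>
    by (simp flip: smult_add_left) (simp add: field_simps)
  then have "\<alpha> \<odot> \<one> = \<alpha>' \<odot> \<one>"
    using 1 2 by metis
  moreover have "\<beta> \<odot> \<one> = ((\<alpha> + \<beta>) / 2) \<odot> \<one> \<oplus> (- 1) \<odot> (((\<alpha> - \<beta>) / 2) \<odot> \<one>)" for \<alpha> \<beta>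
    by (simp add: smult_smult flip: smult_add_left) (simp add: field_simps)
  then have "\<beta> \<odot> \<one> = \<beta>' \<odot> \<one>"
    using 1 2 by metis
  moreover have "c \<odot> x = c \<odot> \<one> \<otimes> x" for c
    using x by (simp add: mult_smult_left)
  ultimately show "\<alpha> \<odot> x = \<alpha>' \<odot> x" "\<beta> \<odot> x = \<beta>' \<odot> x"
    by simp_all
qed

lemma star_d:
  assumes "a \<in> carrier A"
  shows "s (hat_d k a) = hat_dbar k (s a)" "s (hat_dbar k a) = hat_d k (s a)"
  using assms star(1)[OF assms] hat_star_du[of a k, folded A_def] hat_star_dv[of a k, folded A_def]
    derivationD(2)[OF derivation_hat_du[of k], of a, folded A_def]
    derivationD(2)[OF derivation_hat_dv[of k], of a, folded A_def]
  by (simp_all add: hat_d_def hat_dbar_def lincomb_def star flip: A_def)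

text \<open>The operators \<partial>_u and \<partial>_v are hermitian, so taking the adjoint only
  conjugates coefficients; this exchanges \<open>hat_d\<close> and \<open>hat_dbar\<close>, hence
  the swapped arguments.\<close>

lemma der_star_L: "der_star k (L \<alpha> \<beta>) = L (cnj \<beta>) (cnj \<alpha>)"
proof (rule extensionalityI)
  show "der_star k (L \<alpha> \<beta>) \<in> extensional (carrier A)" "L (cnj \<beta>) (cnj \<alpha>) \<in> extensional (carrier A)"
    by (simp_all add: der_star_def lincomb_def A_def)
  show "der_star k (L \<alpha> \<beta>) a = L (cnj \<beta>) (cnj \<alpha>) a" if "a \<in> carrier A" for a
    using that by (simp add: der_star_def flip: A_def)
      (simp add: L_apply star star_d hat_d hat_dbar a_comm)
qed

section \<open>Existence of the connection, with logarithmic derivatives of \<open>S\<close> and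
  \<open>T\<close> as coefficients\<close>

abbreviation G where "G \<equiv> inv S \<otimes> hat_d k S"
abbreviation H where "H \<equiv> inv T \<otimes> hat_dbar k T"

lemma GH_closed [simp]: "G \<in> carrier A" "H \<in> carrier A"
  using S_unit T_unit by (simp_all add: hat_d hat_dbar)

text \<open>The Leibniz rule applied to the prescribed values on the basis. The coefficient of
  \<open>\<Phi>\<close> is the analogue of the Chern connection form of a hermitian metric, with
  \<open>S\<close> as the metric; the coefficient of its conjugate uses \<open>T\<close> and
  \<open>hat_dbar\<close> instead.\<close>

definition N :: conn where
  "N = (\<lambda>(d, X) \<in> lie_g k \<times> vfields k. SOME Y. \<exists>\<alpha> \<beta>. \<exists>a \<in> carrier A. \<exists>b \<in> carrier A.
     d = L \<alpha> \<beta> \<and> X = V a b \<and> Y = V (\<alpha> \<odot> (G \<otimes> a) \<oplus> d a) (\<beta> \<odot> (H \<otimes> b) \<oplus> d b))"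

text \<open>The choice in \<open>N\<close> is harmless: \<open>a\<close> and \<open>b\<close> are
  unique, while \<alpha> and \<beta> enter only as scalars acting on elements of the algebra, and
  those products are determined by the derivation through \<open>L_coeffs\<close>.\<close>

lemma N_apply:
  assumes "a \<in> carrier A" "b \<in> carrier A"
  shows "N (L \<alpha> \<beta>, V a b) = V (\<alpha> \<odot> (G \<otimes> a) \<oplus> L \<alpha> \<beta> a) (\<beta> \<odot> (H \<otimes> b) \<oplus> L \<alpha> \<beta> b)"
proof -
  have "(SOME Y. \<exists>\<alpha>' \<beta>'. \<exists>a' \<in> carrier A. \<exists>b' \<in> carrier A.
     L \<alpha> \<beta> = L \<alpha>' \<beta>' \<and> V a b = V a' b' \<and>
     Y = V (\<alpha>' \<odot> (G \<otimes> a') \<oplus> L \<alpha> \<beta> a') (\<beta>' \<odot> (H \<otimes> b') \<oplus> L \<alpha> \<beta> b')) =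
     V (\<alpha> \<odot> (G \<otimes> a) \<oplus> L \<alpha> \<beta> a) (\<beta> \<odot> (H \<otimes> b) \<oplus> L \<alpha> \<beta> b)" (is "Eps ?Q = ?Y")
  proof (rule some_equality)
    show "?Q ?Y"
      using assms by blast
  next
    fix Y assume "?Q Y"
    then obtain \<alpha>' \<beta>' where "L \<alpha> \<beta> = L \<alpha>' \<beta>'"
      "Y = V (\<alpha>' \<odot> (G \<otimes> a) \<oplus> L \<alpha> \<beta> a) (\<beta>' \<odot> (H \<otimes> b) \<oplus> L \<alpha> \<beta> b)"
      using assms by (auto simp: V_eq_iff)
    then show "Y = ?Y"
      using L_coeffs[of \<alpha> \<beta> \<alpha>' \<beta>'] assms GH_closed by simp
  qed
  then show ?thesis
    using assms by (simp add: N_def)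
qed

lemma derivation_zero: "derivation A d \<Longrightarrow> d \<zero> = \<zero>"
  using derivationD(4)[of A d \<zero> 0] derivationD(2)[of A d \<zero>] by (simp add: smult_0_left)

lemma N_d: "a \<in> carrier A \<Longrightarrow> b \<in> carrier A \<Longrightarrow> N (hat_d k, V a b) = V (G \<otimes> a \<oplus> hat_d k a) (hat_d k b)"
  and N_dbar: "a \<in> carrier A \<Longrightarrow> b \<in> carrier A \<Longrightarrow>
    N (hat_dbar k, V a b) = V (hat_dbar k a) (H \<otimes> b \<oplus> hat_dbar k b)"
  using N_apply[of a b 1 0] N_apply[of a b 0 1]
  by (simp_all add: smult_simps hat_d(1) hat_dbar(1) flip: hat_d_eq hat_dbar_eq)

lemma hat_d_in_lie_g: "hat_d k \<in> lie_g k" "hat_dbar k \<in> lie_g k"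
  using L_in_lie_g[of 1 0] L_in_lie_g[of 0 1] by (simp_all flip: hat_d_eq hat_dbar_eq)

lemma in_lie_gE: assumes "d \<in> lie_g k" obtains \<alpha> \<beta> where "d = L \<alpha> \<beta>"
  using assms by (auto simp: lie_g_eq)

lemma in_vfieldsE:
  assumes "X \<in> vfields k"
  obtains a b where "X = V a b" "a \<in> carrier A" "b \<in> carrier A"
  using assms by (auto simp: vfields_eq)

lemma connection_N: "connection k N"
  unfolding connection_def A_def[symmetric]
proof (intro conjI ballI allI)
  show "N \<in> lie_g k \<times> vfields k \<rightarrow>\<^sub>E vfields k"
  proof (rule PiE_I)
    fix x assume "x \<in> lie_g k \<times> vfields k"
    then show "N x \<in> vfields k"
      by (auto elim!: in_lie_gE in_vfieldsE simp: N_apply L)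
  qed (auto simp: N_def)
next
  fix d d' c c' X assume "d \<in> lie_g k" "d' \<in> lie_g k" "X \<in> vfields k"
  then show "N (lincomb k c d c' d', X) = vadd k (vsmult k c (N (d, X))) (vsmult k c' (N (d', X)))"
    by (auto elim!: in_lie_gE in_vfieldsE simp: lincomb_L N_apply V_ops L V_eq_iff)
      (simp_all add: L_apply hat_d(1) hat_dbar(1) smult_simps smult_add_left a_ac)
next
  fix d c c' X Y assume "d \<in> lie_g k" "X \<in> vfields k" "Y \<in> vfields k"
  then show "N (d, vadd k (vsmult k c X) (vsmult k c' Y)) =
      vadd k (vsmult k c (N (d, X))) (vsmult k c' (N (d, Y)))"
    by (auto elim!: in_lie_gE in_vfieldsE simp: N_apply V_ops L V_eq_iff)
      (simp_all add: L_apply hat_d hat_dbar smult_simps r_distr a_ac mult.commute)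
next
  fix d X a assume "d \<in> lie_g k" "X \<in> vfields k" "a \<in> carrier A"
  then show "N (d, vact k X a) = vadd k (vact k (N (d, X)) a) (vact k X (d a))"
    by (auto elim!: in_lie_gE in_vfieldsE simp: N_apply V_ops L V_eq_iff)
      (simp_all add: L(1) smult_simps l_distr m_assoc a_ac)
qed

lemma S_inv: "a \<in> carrier A \<Longrightarrow> S \<otimes> (inv S \<otimes> a) = a" "a \<in> carrier A \<Longrightarrow> inv S \<otimes> (S \<otimes> a) = a"
  and T_inv: "a \<in> carrier A \<Longrightarrow> T \<otimes> (inv T \<otimes> a) = a" "a \<in> carrier A \<Longrightarrow> inv T \<otimes> (T \<otimes> a) = a"
  using S_unit T_unit by (simp_all flip: m_assoc)

text \<open>The coefficient \<open>G\<close> is defined by \<open>S \<otimes> G = hat_d k S\<close>.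
  Taking adjoints, with \<open>S\<close> self-adjoint, gives the derivative of \<open>S\<close> in
  the conjugate direction; likewise for \<open>T\<close>.\<close>

lemma star_G: "s G \<otimes> S = hat_dbar k S" and star_H: "s H \<otimes> T = hat_d k T"
proof -
  have "s G \<otimes> S = s (S \<otimes> G)" "s H \<otimes> T = s (T \<otimes> H)"
    by (simp_all only: star(4) S_closed T_closed GH_closed star_S star_T)
  then show "s G \<otimes> S = hat_dbar k S" "s H \<otimes> T = hat_d k T"
    by (simp_all add: S_inv T_inv hat_d(1) hat_dbar(1) star_d star_S star_T)
qed

lemma star_L: "a \<in> carrier A \<Longrightarrow> s (L \<alpha> \<beta> a) = L (cnj \<beta>) (cnj \<alpha>) (s a)"
  by (simp add: L_apply star star_d hat_d(1) hat_dbar(1) a_comm)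

text \<open>One diagonal block of the hermitian condition. The Leibniz rule gives three terms; the
  middle one splits by the hypothesis on \<open>P\<close> into a part absorbed by each connection
  term. The conjugate on \<open>c'\<close> is undone by the star. It is applied with
  \<open>P = S\<close>, \<open>K = G\<close> and, with \<alpha> and \<beta> exchanged, with
  \<open>P = T\<close>, \<open>K = H\<close>.\<close>

lemma hermitian_part:
  assumes "a \<in> carrier A" "a' \<in> carrier A" "P \<in> carrier A" "K \<in> carrier A"
    and P: "L \<alpha> \<beta> P = c \<odot> (P \<otimes> K) \<oplus> c' \<odot> (s K \<otimes> P)"
  shows "L \<alpha> \<beta> (s a \<otimes> P \<otimes> a') =
    s (cnj c' \<odot> (K \<otimes> a) \<oplus> L (cnj \<beta>) (cnj \<alpha>) a) \<otimes> P \<otimes> a' \<oplus>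
    s a \<otimes> P \<otimes> (c \<odot> (K \<otimes> a') \<oplus> L \<alpha> \<beta> a')"
  using assms star(1)
  by (simp add: L star star_L l_distr r_distr m_assoc smult_simps a_ac)

lemma hermitian_N: "hermitian_conn k h N"
  unfolding hermitian_conn_def A_def[symmetric]
proof (intro ballI)
  fix d X Y assume "d \<in> lie_g k" "X \<in> vfields k" "Y \<in> vfields k"
  then obtain \<alpha> \<beta> a b a' b' where d: "d = L \<alpha> \<beta>" and X: "X = V a b" and Y: "Y = V a' b'"
    and ab: "a \<in> carrier A" "b \<in> carrier A" "a' \<in> carrier A" "b' \<in> carrier A"
    by (auto elim!: in_lie_gE in_vfieldsE)
  \<comment> \<open>Each direction is expressed by the coefficient that the connection carries:
    directly in one, through its adjoint in the other.\<close>
  have S: "L \<alpha> \<beta> S = \<alpha> \<odot> (S \<otimes> G) \<oplus> \<beta> \<odot> (s G \<otimes> S)"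
    and T: "L \<alpha> \<beta> T = \<beta> \<odot> (T \<otimes> H) \<oplus> \<alpha> \<odot> (s H \<otimes> T)"
    by (simp_all add: S_inv T_inv star_G star_H L_apply hat_d(1) hat_dbar(1) a_comm)
  show "d (h X Y) = h (N (der_star k d, X)) Y \<oplus> h X (N (d, Y))"
    unfolding d X Y der_star_L using ab
    by (simp add: N_apply h_V L(1,2) star(1) hermitian_part[OF ab(1,3) _ _ S]
        hermitian_part[OF ab(2,4) _ _ T] a_ac)
qed

lemma torsion_free_N: "torsion_free k N"
  unfolding torsion_free_def
  by (simp add: Phi_eq Phibar_eq N_d N_dbar derivation_zero derivation_one derivation_hat_d
      derivation_hat_dbar)

lemma almost_complex_N: "almost_complex k N"
  unfolding almost_complex_def
  by (auto elim!: in_lie_gE in_vfieldsE simp: Jmap_V N_apply L V_eq_iff)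
    (simp_all add: L(1) smult_simps mult.commute)

section \<open>Uniqueness of the connection\<close>

lemma connection_values:
  assumes M: "connection k M" "hermitian_conn k h M" "torsion_free k M" "almost_complex k M"
  shows "M (hat_d k, Phi k) = V G \<zero>" "M (hat_dbar k, Phibar k) = V \<zero> H"
    "M (hat_dbar k, Phi k) = V \<zero> \<zero>" "M (hat_d k, Phibar k) = V \<zero> \<zero>"
proof -
  have closed: "M (d, X) \<in> vfields k" if "d \<in> lie_g k" "X \<in> vfields k" for d X
    using M(1) that unfolding connection_def by blast
  have lin: "M (d, vadd k (vsmult k c X) (vsmult k c' Y)) =
      vadd k (vsmult k c (M (d, X))) (vsmult k c' (M (d, Y)))"
    if "d \<in> lie_g k" "X \<in> vfields k" "Y \<in> vfields k" for d c c' X Y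
    using M(1) that unfolding connection_def by blast
  have J: "M (d, Jmap k X) = Jmap k (M (d, X))" if "d \<in> lie_g k" "X \<in> vfields k" for d X
    using M(4) that unfolding almost_complex_def by blast
  \<comment> \<open>Homogeneity is the linearity axiom with second coefficient zero.\<close>
  have scale: "M (d, V (c \<odot> x) (c \<odot> y)) = vsmult k c (M (d, V x y))"
    if "d \<in> lie_g k" "x \<in> carrier A" "y \<in> carrier A" for d c x y
    using lin[OF that(1), of "V x y" "V x y" c 0] that closed[OF that(1), of "V x y"]
    by (auto elim!: in_vfieldsE simp: V_ops smult_simps)
  have half: "x = \<zero>" if "c \<odot> x = (- c) \<odot> x" "c \<noteq> 0" "x \<in> carrier A" for c x
  proof -
    have "(c + c) \<odot> x = c \<odot> x \<oplus> (- c) \<odot> x"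
      using that(1,3) by (metis smult_add_left)
    then have "(c + c) \<odot> x = \<zero>"
      using that(3) by (simp only: smult_minus r_neg smult_closed)
    then have "(1 / (c + c)) \<odot> ((c + c) \<odot> x) = \<zero>"
      by (simp only: smult_0_right)
    then show ?thesis
      using that by (simp add: smult_smult smult_one)
  qed
  have Phi: "\<exists>x \<in> carrier A. M (d, Phi k) = V x \<zero>" if d: "d \<in> lie_g k" for d
  proof -
    obtain x y where xy: "M (d, Phi k) = V x y" "x \<in> carrier A" "y \<in> carrier A"
      using closed[OF d Phi_vfields(1)] by (rule in_vfieldsE)
    \<comment> \<open>The left side is the derivative of \<i>\<Phi>, the right side is
      \<open>J\<close> applied to the derivative of \<Phi>. The second coordinate is therefore equal
      to its own negative.\<close>
    have "V (\<i> \<odot> x) (\<i> \<odot> y) = V (\<i> \<odot> x) ((- \<i>) \<odot> y)"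
      using J[OF d Phi_vfields(1)] scale[OF d, of \<one> \<zero> \<i>] xy
      by (simp add: Phi_eq Jmap_V V_ops smult_0_right)
    then have "y = \<zero>"
      using half[of \<i> y] xy by (simp add: V_eq_iff)
    then show ?thesis
      using xy by blast
  qed
  have Phibar: "\<exists>y \<in> carrier A. M (d, Phibar k) = V \<zero> y" if d: "d \<in> lie_g k" for d
  proof -
    obtain x y where xy: "M (d, Phibar k) = V x y" "x \<in> carrier A" "y \<in> carrier A"
      using closed[OF d Phi_vfields(2)] by (rule in_vfieldsE)
    have "V ((- \<i>) \<odot> x) ((- \<i>) \<odot> y) = V (\<i> \<odot> x) ((- \<i>) \<odot> y)"
      using J[OF d Phi_vfields(2)] scale[OF d, of \<zero> \<one> "- \<i>"] xy
      by (simp add: Phibar_eq Jmap_V V_ops smult_0_right)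
    then have "x = \<zero>"
      using half[of \<i> x] xy by (simp add: V_eq_iff)
    then show ?thesis
      using xy by blast
  qed
  have dstar: "der_star k (hat_d k) = hat_dbar k" "der_star k (hat_dbar k) = hat_d k"
    using der_star_L[of 1 0] der_star_L[of 0 1] by (simp_all flip: hat_d_eq hat_dbar_eq)
  obtain x y z w where *: "M (hat_d k, Phi k) = V x \<zero>" "M (hat_dbar k, Phi k) = V y \<zero>"
    "M (hat_d k, Phibar k) = V \<zero> z" "M (hat_dbar k, Phibar k) = V \<zero> w"
    and closed': "x \<in> carrier A" "y \<in> carrier A" "z \<in> carrier A" "w \<in> carrier A"
    using Phi Phibar hat_d_in_lie_g by metis
  have yz: "y = \<zero>" "z = \<zero>"
    using M(3) * closed' unfolding torsion_free_def by (auto simp: V_eq_iff)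
  have herm: "d (h X Y) = h (M (der_star k d, X)) Y \<oplus> h X (M (d, Y))"
    if "d \<in> lie_g k" "X \<in> vfields k" "Y \<in> vfields k" for d X Y
    using M(2) that unfolding hermitian_conn_def A_def by blast
  \<comment> \<open>The adjoint of \<open>hat_d\<close> is \<open>hat_dbar\<close>, so the other
    term of the hermitian condition contains the derivative of \<Phi> along \<open>hat_dbar\<close>,
    which is already zero.\<close>
  have "hat_d k S = S \<otimes> x"
    using herm[OF hat_d_in_lie_g(1), of "Phi k" "Phi k"] closed'
    by (simp add: h_Phi dstar *) (simp add: Phi_eq h_V yz star_zero star_one)
  then have x: "x = G"
    using closed' by (simp add: S_inv)
  have "hat_dbar k T = T \<otimes> w"
    using herm[OF hat_d_in_lie_g(2), of "Phibar k" "Phibar k"] closed'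
    by (simp add: h_Phibar dstar *) (simp add: Phibar_eq h_V yz star_zero star_one)
  then have w: "w = H"
    using closed' by (simp add: T_inv)
  show "M (hat_d k, Phi k) = V G \<zero>" "M (hat_dbar k, Phibar k) = V \<zero> H"
    "M (hat_dbar k, Phi k) = V \<zero> \<zero>" "M (hat_d k, Phibar k) = V \<zero> \<zero>"
    using * x w yz by simp_all
qed

text \<open>Additivity, the Leibniz rule and linearity in the derivation express a connection
  through its four values on the basis, so two connections with the same four values
  coincide.\<close>

lemma connection_apply:
  assumes M: "connection k M" and ab: "a \<in> carrier A" "b \<in> carrier A"
  shows "M (L \<alpha> \<beta>, V a b) = vadd k
    (vadd k
      (vact k (vadd k (vsmult k \<alpha> (M (hat_d k, Phi k))) (vsmult k \<beta> (M (hat_dbar k, Phi k)))) a)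
      (vact k (Phi k) (L \<alpha> \<beta> a)))
    (vadd k
      (vact k (vadd k (vsmult k \<alpha> (M (hat_d k, Phibar k))) (vsmult k \<beta> (M (hat_dbar k, Phibar k)))) b)
      (vact k (Phibar k) (L \<alpha> \<beta> b)))"
proof -
  \<comment> \<open>Linearity is available only jointly with scalars; additivity is its instance
    with both coefficients 1.\<close>
  have one: "vsmult k 1 X = X" if "X \<in> vfields k" for X
    using that by (auto elim!: in_vfieldsE simp: V_ops smult_one)
  have closed: "M (d, X) \<in> vfields k" if "d \<in> lie_g k" "X \<in> vfields k" for d X
    using M that unfolding connection_def by blast
  have "M (d, vadd k (vsmult k 1 X) (vsmult k 1 Y)) =
      vadd k (vsmult k 1 (M (d, X))) (vsmult k 1 (M (d, Y)))"
    if "d \<in> lie_g k" "X \<in> vfields k" "Y \<in> vfields k" for d X Y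
    using M that unfolding connection_def by blast
  then have add: "M (d, vadd k X Y) = vadd k (M (d, X)) (M (d, Y))"
    if "d \<in> lie_g k" "X \<in> vfields k" "Y \<in> vfields k" for d X Y
    using that by (simp add: one closed)
  have leibniz: "M (d, vact k X c) = vadd k (vact k (M (d, X)) c) (vact k X (d c))"
    if "d \<in> lie_g k" "X \<in> vfields k" "c \<in> carrier A" for d X c
    using M that unfolding connection_def A_def by blast
  have L: "M (L \<alpha> \<beta>, X) = vadd k (vsmult k \<alpha> (M (hat_d k, X))) (vsmult k \<beta> (M (hat_dbar k, X)))"
    if "X \<in> vfields k" for X
    using M that hat_d_in_lie_g unfolding connection_def by blast
  have "vact k (Phi k) a \<in> vfields k" "vact k (Phibar k) b \<in> vfields k"
    using ab by (auto simp: Phi_act Phibar_act)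
  then show ?thesis
    unfolding V_def using ab by (simp only: add leibniz L L_in_lie_g Phi_vfields)
qed

lemma connection_unique:
  assumes M: "connection k M" "hermitian_conn k h M" "torsion_free k M" "almost_complex k M"
  shows "M = N"
proof (rule PiE_ext)
  show "M \<in> lie_g k \<times> vfields k \<rightarrow>\<^sub>E vfields k"
    using M(1) unfolding connection_def by (rule conjunct1)
  show "N \<in> lie_g k \<times> vfields k \<rightarrow>\<^sub>E vfields k"
    using connection_N unfolding connection_def by (rule conjunct1)
  fix p assume "p \<in> lie_g k \<times> vfields k"
  then obtain \<alpha> \<beta> a b where p: "p = (L \<alpha> \<beta>, V a b)" and ab: "a \<in> carrier A" "b \<in> carrier A"
    by (auto elim!: in_lie_gE in_vfieldsE)
  show "M p = N p"
    \<comment> \<open>Since \<open>N\<close> satisfies all four conditions itself,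
      \<open>connection_values\<close> yields its values too, and they are those of
      \<open>M\<close>.\<close>
    unfolding p connection_apply[OF M(1) ab] connection_apply[OF connection_N ab]
      connection_values[OF M]
      connection_values[OF connection_N hermitian_N torsion_free_N almost_complex_N] ..
qed

end

theorem theorem3p3:
  fixes k :: real and S T :: hat and h :: "vec3 \<Rightarrow> vec3 \<Rightarrow> hat"
  assumes "S \<in> Units (hat_alg k)" and "T \<in> Units (hat_alg k)"
    and "hermitian_form k h"
    and "h (Phi k) (Phi k) = S"
    and "h (Phibar k) (Phibar k) = T"
    and "h (Phi k) (Phibar k) = \<zero>\<^bsub>hat_alg k\<^esub>"
  shows "(\<exists>!N. connection k N \<and> hermitian_conn k h N \<and> torsion_free k N \<and> almost_complex k N) \<and>
    (\<forall>N. connection k N \<and> hermitian_conn k h N \<and> torsion_free k N \<and> almost_complex k N \<longrightarrow>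
       N (hat_d k, Phi k) = vact k (Phi k) (inv\<^bsub>hat_alg k\<^esub> S \<otimes>\<^bsub>hat_alg k\<^esub> hat_d k S) \<and>
       N (hat_dbar k, Phibar k) = vact k (Phibar k) (inv\<^bsub>hat_alg k\<^esub> T \<otimes>\<^bsub>hat_alg k\<^esub> hat_dbar k T) \<and>
       N (hat_dbar k, Phi k) = vzero k \<and>
       N (hat_d k, Phibar k) = vzero k)"
proof -
  interpret catenoid_form k "hat_alg k" S T h
    by (rule catenoid_form.intro[OF HOL.refl assms])
  show ?thesis
  proof (intro conjI ex1I[of _ N] allI impI connection_N hermitian_N torsion_free_N almost_complex_N;
      elim conjE)
    fix M
    assume M: "connection k M" "hermitian_conn k h M" "torsion_free k M" "almost_complex k M"
    show "M = N"
      by (rule connection_unique[OF M])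
    show "M (hat_d k, Phi k) = vact k (Phi k) G" "M (hat_dbar k, Phibar k) = vact k (Phibar k) H"
      "M (hat_dbar k, Phi k) = vzero k" "M (hat_d k, Phibar k) = vzero k"
      by (simp_all add: connection_values[OF M] Phi_act Phibar_act vzero_eq)
  qed
qed

end
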